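(* Consider $$\partial_t u_t(x)=\mathcal{L}u_t(x)+\sigma(u_t(x))\dot W(t,x),\qquad t>0,\ x\in\mathbb{R}.$$ There exist $t_0\geq0$ and a positive constant $K$ such that, for every non-negative initial condition $u_0$ with $K_{u_0}:=\int_{B(0,1)}u_0(x)\,\mathrm{d}x>0$, the solution $u_t$ satisfies, for all $t\geq t_0$ and $x\in\mathbb{R}$, $$\mathbb{E}|u_t(x)|^2=\infty\quad\text{whenever}\quad K_{u_0}\geq K.$$
   Context: Here $d=1$, $1<\alpha<2$ and $B(0,1)$ is the unit ball of $\mathbb{R}$. The operator $\mathcal{L}=-(-\Delta)^{\alpha/2}$ is the fractional Laplacian, i.e. the generator of the symmetric (strictly) $\alpha$-stable process on $\mathbb{R}$, and $p_t(\cdot)$ denotes its heat kernel (transition density). $\dot W$ is space-time white noise. The function $\sigma:\mathbb{R}\to\mathbb{R}$ is locally Lipschitz and there is a $\gamma>0$ such that $\sigma(x)\geq|x|^{1+\gamma}$ for all $x\in\mathbb{R}$. The initial condition $u_0$ is a non-negative bounded deterministic function. The solution is understood in the mild sense of Walsh: $u$ is adapted to the filtration generated by the noise and satisfies $$u_t(x)=(\mathcal{G}u)_t(x)+\int_{\mathbb{R}}\int_0^t p_{t-s}(x-y)\sigma(u_s(y))\,W(\mathrm{d}s\,\mathrm{d}y),\qquad (\mathcal{G}u)_t(x):=\int_{\mathbb{R}}p_t(x-y)u_0(y)\,\mathrm{d}y.$$ Since $\sigma$ is only locally Lipschitz, existence and uniqueness is understood locally, i.e. on $(0,\min(t,\tau_N))$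 with $\tau_N:=\inf\{t>0:\sup_{x}|u_t(x)|>N\}$. Moments take values in $[0,\infty]$. *)

theory Defs
  imports "HOL-Probability.Probability"
begin

text \<open>
  The transition density of the symmetric \<open>\<alpha>\<close>-stable process, whose generator is
  \<open>- (- \<Delta>)\<^sup>\<alpha>\<^sup>/\<^sup>2\<close>: for each \<open>t > 0\<close> the law of the process at time \<open>t\<close> (started at the origin)
  has characteristic function \<open>\<xi> \<mapsto> exp (- t \<bar>\<xi>\<bar>\<^sup>\<alpha>)\<close>. Continuity selects the usual
  version of the density, so the kernel is unique for \<open>t > 0\<close>.
\<close>

definition stable_heat_kernel :: "real \<Rightarrow> (real \<Rightarrow> real \<Rightarrow> real) \<Rightarrow> bool" where
  "stable_heat_kernel \<alpha> p \<longleftrightarrow>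
     (\<forall>t>0. continuous_on UNIV (p t) \<and> (\<forall>x. 0 \<le> p t x) \<and>
        prob_space (density lborel (\<lambda>x. ennreal (p t x))) \<and>
        (\<forall>\<xi>. char (density lborel (\<lambda>x. ennreal (p t x))) \<xi>
              = complex_of_real (exp (- t * \<bar>\<xi>\<bar> powr \<alpha>))))"

definition heat_flow :: "(real \<Rightarrow> real \<Rightarrow> real) \<Rightarrow> (real \<Rightarrow> real) \<Rightarrow> real \<Rightarrow> real \<Rightarrow> real" where
  "heat_flow p u0 t x = (LINT y|lborel. p t (x - y) * u0 y)"

definition locally_lipschitz :: "(real \<Rightarrow> real) \<Rightarrow> bool" where
  "locally_lipschitz f \<longleftrightarrow> (\<forall>x. \<exists>e>0. \<exists>L. L-lipschitz_on (cball x e) f)"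


section \<open>Space-time white noise\<close>

text \<open>Points of space-time are pairs (time, space).\<close>

definition noise_sets :: "(real \<times> real) set set" where
  "noise_sets = {A \<in> sets borel. A \<subseteq> {0..} \<times> UNIV \<and> emeasure lborel A < \<infinity>}"

definition centred_normal :: "real \<Rightarrow> real measure" where
  "centred_normal v =
     (if v = 0 then return borel 0 else density lborel (\<lambda>x. ennreal (normal_density 0 (sqrt v) x)))"

definition white_noise :: "'a measure \<Rightarrow> ((real \<times> real) set \<Rightarrow> 'a \<Rightarrow> real) \<Rightarrow> bool" where
  "white_noise M W \<longleftrightarrow>
     prob_space M \<and>
     (\<forall>A\<in>noise_sets. W A \<in> borel_measurable M \<and>
        distr M borel (W A) = centred_normal (measure lborel A)) \<and>
     (\<forall>F. finite F \<and> F \<subseteq> noise_sets \<and> disjoint F \<longrightarrow>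
        prob_space.indep_vars M (\<lambda>_. borel) W F) \<and>
     (\<forall>A\<in>noise_sets. \<forall>B\<in>noise_sets. A \<inter> B = {} \<longrightarrow>
        (AE \<omega> in M. W (A \<union> B) \<omega> = W A \<omega> + W B \<omega>))"

text \<open>The filtration generated by the noise, augmented by the null sets.\<close>

definition noise_filtration ::
  "'a measure \<Rightarrow> ((real \<times> real) set \<Rightarrow> 'a \<Rightarrow> real) \<Rightarrow> real \<Rightarrow> 'a measure" where
  "noise_filtration M W t =
     sigma (space M)
       ({W A -` B \<inter> space M | A B. A \<in> noise_sets \<and> A \<subseteq> {0..t} \<times> UNIV \<and> B \<in> sets borel}
        \<union> null_sets M)"


section \<open>The Walsh integral\<close>

text \<open>
  A list of quadruples \<open>(a, b, A, X)\<close> encodes the simple integrand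
  \<open>\<Sum> X(\<omega>) 1\<^bsub>(a,b]\<^esub>(s) 1\<^bsub>A\<^esub>(y)\<close>, where each \<open>X\<close> is bounded and known at time \<open>a\<close>.
\<close>

type_synonym 'a simple_integrand = "(real \<times> real \<times> real set \<times> ('a \<Rightarrow> real)) list"

definition simple_integrand ::
  "'a measure \<Rightarrow> ((real \<times> real) set \<Rightarrow> 'a \<Rightarrow> real) \<Rightarrow> 'a simple_integrand \<Rightarrow> bool" where
  "simple_integrand M W S \<longleftrightarrow>
     (\<forall>(a, b, A, X) \<in> set S. 0 \<le> a \<and> a \<le> b \<and>
        A \<in> sets borel \<and> emeasure lborel A < \<infinity> \<and>
        X \<in> borel_measurable (noise_filtration M W a) \<and> bounded (X ` space M))"

definition simple_fun :: "'a simple_integrand \<Rightarrow> 'a \<Rightarrow> real \<Rightarrow> real \<Rightarrow> real" where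
  "simple_fun S \<omega> s y = (\<Sum>(a, b, A, X)\<leftarrow>S. X \<omega> * indicator {a<..b} s * indicator A y)"

definition simple_integral ::
  "((real \<times> real) set \<Rightarrow> 'a \<Rightarrow> real) \<Rightarrow> 'a simple_integrand \<Rightarrow> 'a \<Rightarrow> real" where
  "simple_integral W S \<omega> = (\<Sum>(a, b, A, X)\<leftarrow>S. X \<omega> * W ({a<..b} \<times> A) \<omega>)"

text \<open>
  \<open>has_walsh_integral M W \<Phi> I\<close>: the random field \<open>\<Phi>\<close> is in the closure of the simple integrands in
  \<open>L\<^sup>2(P(d\<omega>) ds dy)\<close>, and \<open>I\<close> is (a version of) its integral, the limit in \<open>L\<^sup>2(P)\<close> of the integrals
  of the approximating simple integrands.
\<close>

definition has_walsh_integral ::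
  "'a measure \<Rightarrow> ((real \<times> real) set \<Rightarrow> 'a \<Rightarrow> real) \<Rightarrow> ('a \<Rightarrow> real \<Rightarrow> real \<Rightarrow> real) \<Rightarrow>
   ('a \<Rightarrow> real) \<Rightarrow> bool" where
  "has_walsh_integral M W \<Phi> I \<longleftrightarrow>
     (\<lambda>(\<omega>, s, y). \<Phi> \<omega> s y) \<in> borel_measurable (M \<Otimes>\<^sub>M lborel) \<and>
     I \<in> borel_measurable M \<and>
     (\<exists>S. (\<forall>n. simple_integrand M W (S n)) \<and>
        (\<lambda>n. \<integral>\<^sup>+ (\<omega>, s, y). ennreal ((simple_fun (S n) \<omega> s y - \<Phi> \<omega> s y)\<^sup>2) \<partial>(M \<Otimes>\<^sub>M lborel))
          \<longlonglongrightarrow> 0 \<and>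
        (\<lambda>n. \<integral>\<^sup>+ \<omega>. ennreal ((simple_integral W (S n) \<omega> - I \<omega>)\<^sup>2) \<partial>M) \<longlonglongrightarrow> 0)"


section \<open>Mild solutions\<close>

text \<open>A random field is a function of time, space and the sample point, in this order.\<close>

type_synonym 'a random_field = "real \<Rightarrow> real \<Rightarrow> 'a \<Rightarrow> real"

definition second_moment :: "'a measure \<Rightarrow> 'a random_field \<Rightarrow> real \<Rightarrow> real \<Rightarrow> ennreal" where
  "second_moment M u t x = (\<integral>\<^sup>+ \<omega>. ennreal (\<bar>u t x \<omega>\<bar>\<^sup>2) \<partial>M)"

definition exit_time :: "'a random_field \<Rightarrow> nat \<Rightarrow> 'a \<Rightarrow> ereal" where
  "exit_time u N \<omega> = Inf {ereal t | t. t > 0 \<and> (SUP x. ereal \<bar>u t x \<omega>\<bar>) > ereal (real N)}"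

definition mild_integrand ::
  "(real \<Rightarrow> real \<Rightarrow> real) \<Rightarrow> (real \<Rightarrow> real) \<Rightarrow> 'a random_field \<Rightarrow> real \<Rightarrow> real \<Rightarrow>
   'a \<Rightarrow> real \<Rightarrow> real \<Rightarrow> real" where
  "mild_integrand p \<sigma> u t x \<omega> s y =
     (if 0 < s \<and> s < t then p (t - s) (x - y) * \<sigma> (u s y \<omega>) else 0)"

definition adapted_field ::
  "'a measure \<Rightarrow> ((real \<times> real) set \<Rightarrow> 'a \<Rightarrow> real) \<Rightarrow> 'a random_field \<Rightarrow> bool" where
  "adapted_field M W u \<longleftrightarrow>
     (\<lambda>(\<omega>, t, x). if 0 < t then u t x \<omega> else 0) \<in> borel_measurable (M \<Otimes>\<^sub>M lborel) \<and>
     (\<forall>t>0. \<forall>x. u t x \<in> borel_measurable (noise_filtration M W t))"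

text \<open>
  The mild equation on the random interval up to each exit time: the integral is taken over
  \<open>s < min t \<tau>\<^sub>N\<close>, and the identity is required on the event \<open>t < \<tau>\<^sub>N\<close>.
\<close>

definition local_mild_equation ::
  "'a measure \<Rightarrow> ((real \<times> real) set \<Rightarrow> 'a \<Rightarrow> real) \<Rightarrow> (real \<Rightarrow> real \<Rightarrow> real) \<Rightarrow> (real \<Rightarrow> real) \<Rightarrow>
   (real \<Rightarrow> real) \<Rightarrow> 'a random_field \<Rightarrow> bool" where
  "local_mild_equation M W p \<sigma> u0 u \<longleftrightarrow>
     (\<forall>N. \<forall>t>0. \<forall>x. \<exists>I.
        has_walsh_integral M W
          (\<lambda>\<omega> s y. if ereal s < exit_time u N \<omega> then mild_integrand p \<sigma> u t x \<omega> s y else 0) I \<and>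
        (AE \<omega> in M. ereal t < exit_time u N \<omega> \<longrightarrow> u t x \<omega> = heat_flow p u0 t x + I \<omega>))"

definition mild_equation_at ::
  "'a measure \<Rightarrow> ((real \<times> real) set \<Rightarrow> 'a \<Rightarrow> real) \<Rightarrow> (real \<Rightarrow> real \<Rightarrow> real) \<Rightarrow> (real \<Rightarrow> real) \<Rightarrow>
   (real \<Rightarrow> real) \<Rightarrow> 'a random_field \<Rightarrow> real \<Rightarrow> real \<Rightarrow> bool" where
  "mild_equation_at M W p \<sigma> u0 u t x \<longleftrightarrow>
     (\<exists>I. has_walsh_integral M W (mild_integrand p \<sigma> u t x) I \<and>
          (AE \<omega> in M. u t x \<omega> = heat_flow p u0 t x + I \<omega>))"

text \<open>
  Since \<open>\<sigma>\<close> grows superlinearly, a solution may leave \<open>L\<^sup>2\<close>, and the Walsh integral, an \<open>L\<^sup>2\<close> object,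
  is then undefined. A solution therefore satisfies the mild equation locally (up to every exit
  time), and satisfies it in Walsh's sense, over the whole of \<open>(0,t) \<times> \<real>\<close>, at all those \<open>(t,x)\<close> at
  which its second moment is finite. At the other points of space-time only the local equation
  is required. The second requirement does not follow from the first: a stochastic integral
  defined by localisation may be square integrable (a strict local martingale, say) although its
  integrand is not in \<open>L\<^sup>2(P(d\<omega>) ds dy)\<close>, and then it is not a Walsh integral.
  A field for which the Walsh integral exists and the mild equation holds at every \<open>(t,x)\<close>
  satisfies the second requirement everywhere.
\<close>

definition mild_solution ::
  "'a measure \<Rightarrow> ((real \<times> real) set \<Rightarrow> 'a \<Rightarrow> real) \<Rightarrow> (real \<Rightarrow> real \<Rightarrow> real) \<Rightarrow> (real \<Rightarrow> real) \<Rightarrow>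
   (real \<Rightarrow> real) \<Rightarrow> 'a random_field \<Rightarrow> bool" where
  "mild_solution M W p \<sigma> u0 u \<longleftrightarrow>
     adapted_field M W u \<and>
     local_mild_equation M W p \<sigma> u0 u \<and>
     (\<forall>t>0. \<forall>x. second_moment M u t x < \<infinity> \<longrightarrow> mild_equation_at M W p \<sigma> u0 u t x)"

text \<open>Bounded non-negative (deterministic, Borel) initial data.\<close>

definition initial_condition :: "(real \<Rightarrow> real) \<Rightarrow> bool" where
  "initial_condition u0 \<longleftrightarrow>
     u0 \<in> borel_measurable borel \<and> bounded (range u0) \<and> (\<forall>x. 0 \<le> u0 x)"

definition initial_mass :: "(real \<Rightarrow> real) \<Rightarrow> real" where
  "initial_mass u0 = (LINT x:ball 0 1|lborel. u0 x)"

end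

theory Submission
  imports Defs "HOL-Real_Asymp.Real_Asymp"
begin

text \<open>
  At every point \<open>f t x = E \<bar>u t x\<bar>\<^sup>2\<close> dominates a constant times
  \<open>(\<G>u)\<^sup>2 + \<integral>\<integral> p\<^sup>2 E \<sigma>(u)\<^sup>2\<close>: where \<open>f\<close> is infinite there is nothing to prove, elsewhere
  this is the isometry of the Walsh integral. Since \<open>\<sigma>(u)\<^sup>2 \<ge> \<bar>u\<bar>\<^bsup>2 + 2\<gamma>\<^esup>\<close>, a lower bound \<open>A\<close> for \<open>f\<close> on a
  space-time box reproduces itself, a time \<open>\<delta>\<close> later, as \<open>c \<delta>\<^sup>2 A\<^bsup>1 + \<gamma>\<^esup>\<close>; if \<open>A\<close> is large to begin
  with, which the mass of the initial condition ensures, iterating along \<open>\<delta> = 2\<^bsup>-n\<^esup>\<close> gives \<open>f = \<infinity>\<close> on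
  a box. The kernel is bounded below only on \<open>\<bar>x\<bar> \<le> \<eta> t\<^bsup>1/\<alpha>\<^esup>\<close>, so \<open>n\<close> steps of length \<open>1/n\<close> carry the
  value \<open>\<infinity>\<close> over a distance of order \<open>n \<cdot> n\<^bsup>-1/\<alpha>\<^esup>\<close>, which is unbounded because \<open>\<alpha> > 1\<close>.
\<close>

section \<open>Preliminaries\<close>

text \<open>No regularity of \<open>f\<close> is at hand: it takes values in [0, infinity] and may
  be infinite at isolated points. Every estimate is therefore a lower bound valid at each single
  point. Three obstacles shape the rest. The kernel is known only through its characteristic
  function, so its lower bound comes from scaling and from positivity at the origin, which is
  obtained by testing against narrow Gaussians. The noise is independent only over disjoint sets, so
  its independence of the past requires cutting overlapping sets into atoms. The bounds for time and
  mass must be fixed before the initial condition and the solution; they are built from \<alpha>,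
  \<gamma>, \<kappa> and \<eta> alone. The two iterations use different time steps for a reason. A
  finite lower bound loses a power of \<delta> at each step while the delays must stay summable,
  which suggests geometric steps. The value infinity loses nothing, so arbitrarily many equal steps
  of total duration 1 are allowed, and the waiting time does not depend on \<open>x\<close>.\<close>

lemma sum_list_case4:
  "(\<Sum>(a, b, A, X)\<leftarrow>S. f a b A X) =
    (\<Sum>i<length S. f (fst (S ! i)) (fst (snd (S ! i))) (fst (snd (snd (S ! i)))) (snd (snd (snd (S ! i)))))"
  by (simp add: sum_list_sum_nth atLeast0LessThan case_prod_beta)

lemma ennreal_sq_le: "ennreal (a\<^sup>2) \<le> 2 * ennreal (b\<^sup>2) + 2 * ennreal ((b - a)\<^sup>2)"
proof -
  \<comment> \<open>The right-hand side minus the left-hand side is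
    \<open>(2 * b - a)\<^sup>2\<close>.\<close>
  have "a\<^sup>2 \<le> 2 * b\<^sup>2 + 2 * (b - a)\<^sup>2"
    using zero_le_power2[of "a - 2 * (a - b)"] by (simp add: power2_eq_square algebra_simps)
  then have "ennreal (a\<^sup>2) \<le> ennreal (2 * b\<^sup>2 + 2 * (b - a)\<^sup>2)"
    by (rule ennreal_leI)
  then show ?thesis
    by (simp add: ennreal_plus ennreal_mult'')
qed

lemma bounded_mult:
  fixes X Y :: "'a \<Rightarrow> real"
  assumes "bounded (X ` A)" "bounded (Y ` A)"
  shows "bounded ((\<lambda>\<omega>. X \<omega> * Y \<omega>) ` A)"
proof -
  obtain c d where "\<bar>X \<omega>\<bar> \<le> c" "\<bar>Y \<omega>\<bar> \<le> d" if "\<omega> \<in> A" for \<omega>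
    using assms unfolding bounded_iff by auto
  then have "\<bar>X \<omega> * Y \<omega>\<bar> \<le> \<bar>c\<bar> * \<bar>d\<bar>" if "\<omega> \<in> A" for \<omega>
    unfolding abs_mult using that by (intro mult_mono) force+
  then show ?thesis
    unfolding bounded_iff by auto
qed

lemma bounded_mult_integrable:
  fixes X Z :: "'a \<Rightarrow> real"
  assumes [measurable]: "X \<in> borel_measurable M" and "bounded (X ` space M)" "integrable M Z"
  shows "integrable M (\<lambda>\<omega>. X \<omega> * Z \<omega>)"
proof -
  obtain c where c: "\<bar>X \<omega>\<bar> \<le> c" if "\<omega> \<in> space M" for \<omega>
    using assms(2) unfolding bounded_iff by auto
  have "integrable M (\<lambda>\<omega>. c * Z \<omega>)"
    using assms(3) by simp
  then show ?thesis
  proof (rule Bochner_Integration.integrable_bound)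
    show "(\<lambda>\<omega>. X \<omega> * Z \<omega>) \<in> borel_measurable M"
      using assms(3) by measurable
    have "\<bar>X \<omega>\<bar> * \<bar>Z \<omega>\<bar> \<le> \<bar>c\<bar> * \<bar>Z \<omega>\<bar>" if "\<omega> \<in> space M" for \<omega>
      using c[OF that] by (intro mult_right_mono) auto
    then show "AE \<omega> in M. norm (X \<omega> * Z \<omega>) \<le> norm (c * Z \<omega>)"
      by (auto simp: abs_mult)
  qed
qed

lemma (in prob_space) indep_set_mono_left:
  assumes "indep_set A B" "A' \<subseteq> A"
  shows "indep_set A' B"
  using assms unfolding indep_sets2_eq by blast

text \<open>The factor 4 is the one lost in \<open>walsh_integral_lower_bound\<close>; with it built
  in, the step inequalities can be used as they stand.\<close>

lemma ennreal_top_if_unbounded: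
  assumes "\<And>v. 0 < v \<Longrightarrow> ennreal v \<le> 4 * a"
  shows "a = (\<infinity> :: ennreal)"
proof (rule ccontr)
  assume "a \<noteq> \<infinity>"
  then obtain b where b: "a = ennreal b" "0 \<le> b"
    by (cases a) auto
  then have "ennreal (4 * b + 1) \<le> ennreal (4 * b)"
    using assms[of "4 * b + 1"] by (simp add: ennreal_mult')
  then show False
    using b by (subst (asm) ennreal_le_iff) auto
qed

text \<open>Jensen's inequality up to a factor \<open>2 powr (1 + \<gamma>)\<close>, in a form that
  also covers infinite moments. It is the integral of the pointwise bound \<open>pt\<close>, whose
  two cases are separated by the level \<open>x\<^sup>2 = l\<close>.\<close>

lemma ennreal_power_mono_moment:
  assumes [measurable]: "f \<in> borel_measurable M" and "prob_space M"
    and A: "0 < A" "ennreal A \<le> (\<integral>\<^sup>+ \<omega>. ennreal ((f \<omega>)\<^sup>2) \<partial>M)" and \<gamma>: "0 < \<gamma>"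
  shows "ennreal ((A / 2) powr (1 + \<gamma>)) \<le> (\<integral>\<^sup>+ \<omega>. ennreal ((\<bar>f \<omega>\<bar> powr (1 + \<gamma>))\<^sup>2) \<partial>M)"
proof -
  interpret prob_space M by fact
  define l where "l = A / 2"
  have l: "0 < l" using A by (simp add: l_def)
  let ?J = "\<integral>\<^sup>+ \<omega>. ennreal ((\<bar>f \<omega>\<bar> powr (1 + \<gamma>))\<^sup>2) \<partial>M"
  have pt: "l powr \<gamma> * x\<^sup>2 \<le> l powr (1 + \<gamma>) + (\<bar>x\<bar> powr (1 + \<gamma>))\<^sup>2" for x
  proof (cases "x\<^sup>2 \<le> l")
    case True
    then have "l powr \<gamma> * x\<^sup>2 \<le> l powr \<gamma> * l"
      by (intro mult_left_mono) auto
    also have "\<dots> = l powr (1 + \<gamma>)"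
      using l by (simp add: powr_add)
    finally show ?thesis
      by (simp add: add_increasing2)
  next
    case False
    then have x: "0 < \<bar>x\<bar>" using l by auto
    have "(\<bar>x\<bar> powr (1 + \<gamma>))\<^sup>2 = (\<bar>x\<bar> powr \<gamma>)\<^sup>2 * x\<^sup>2"
      using x by (simp add: powr_add power_mult_distrib mult.commute)
    moreover have "(\<bar>x\<bar> powr \<gamma>)\<^sup>2 = (x\<^sup>2) powr \<gamma>"
    proof -
      have "(\<bar>x\<bar> powr \<gamma>)\<^sup>2 = (\<bar>x\<bar> * \<bar>x\<bar>) powr \<gamma>"
        by (simp only: powr_mult power2_eq_square)
      also have "\<bar>x\<bar> * \<bar>x\<bar> = x\<^sup>2" by (simp add: power2_eq_square)
      finally show ?thesis .
    qed
    moreover have "l powr \<gamma> \<le> (x\<^sup>2) powr \<gamma>"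
      using False l \<gamma> by (intro powr_mono2) auto
    ultimately have "l powr \<gamma> * x\<^sup>2 \<le> (\<bar>x\<bar> powr (1 + \<gamma>))\<^sup>2"
      by (simp add: mult_right_mono)
    then show ?thesis
      by (simp add: add_increasing)
  qed
  have "ennreal (l powr \<gamma> * A) = ennreal (l powr \<gamma>) * ennreal A"
    by (simp add: ennreal_mult')
  also have "\<dots> \<le> ennreal (l powr \<gamma>) * (\<integral>\<^sup>+ \<omega>. ennreal ((f \<omega>)\<^sup>2) \<partial>M)"
    using A by (intro mult_left_mono) auto
  also have "\<dots> = (\<integral>\<^sup>+ \<omega>. ennreal (l powr \<gamma> * (f \<omega>)\<^sup>2) \<partial>M)"
    by (simp add: nn_integral_cmult ennreal_mult')
  also have "\<dots> \<le> (\<integral>\<^sup>+ \<omega>. ennreal (l powr (1 + \<gamma>)) + ennreal ((\<bar>f \<omega>\<bar> powr (1 + \<gamma>))\<^sup>2) \<partial>M)"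
    using pt by (intro nn_integral_mono) (simp add: ennreal_plus[symmetric] ennreal_leI del: ennreal_plus)
  also have "\<dots> = ennreal (l powr (1 + \<gamma>)) + ?J"
    by (simp add: nn_integral_add emeasure_space_1)
  finally have *: "ennreal (l powr \<gamma> * A) \<le> ennreal (l powr (1 + \<gamma>)) + ?J" .
  \<comment> \<open>The choice \<open>l = A / 2\<close> makes the left-hand side twice the finite
    error term, so that one copy of it cancels.\<close>
  have "l powr \<gamma> * A = l powr (1 + \<gamma>) + l powr (1 + \<gamma>)"
    using l by (simp add: l_def powr_add field_simps)
  then have "ennreal (l powr \<gamma> * A) = ennreal (l powr (1 + \<gamma>)) + ennreal (l powr (1 + \<gamma>))"
    by (simp only: ennreal_plus powr_ge_zero)
  with * have "ennreal (l powr (1 + \<gamma>)) + ennreal (l powr (1 + \<gamma>)) \<le> ennreal (l powr (1 + \<gamma>)) + ?J"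
    by (simp only:)
  then show ?thesis
    by (simp add: ennreal_add_left_cancel_le l_def)
qed

text \<open>The equality set is closed, and a closed set of full Lebesgue measure is the whole line.
  This turns uniqueness of densities into a pointwise identity of kernels.\<close>

lemma continuous_AE_eq:
  fixes f g :: "real \<Rightarrow> real"
  assumes "continuous_on UNIV f" "continuous_on UNIV g" "AE x in lborel. f x = g x"
  shows "f = g"
proof
  fix x
  have "closed {x. f x = g x}"
    using assms(1,2) by (intro closed_Collect_eq)
  moreover have "AE x in lebesgue. x \<in> {x. f x = g x}"
    using AE_completion[OF assms(3)] by simp
  ultimately show "f x = g x"
    using mem_closed_if_AE_lebesgue by blast
qed

section \<open>White noise and its filtration\<close>

lemma noise_setsD:
  assumes "A \<in> noise_sets"
  shows "A \<in> sets borel" "A \<subseteq> {0..} \<times> UNIV" "emeasure lborel A < \<infinity>"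
  using assms by (auto simp: noise_sets_def)

lemma noise_sets_subset:
  assumes "A \<in> noise_sets" "B \<in> sets borel" "B \<subseteq> A"
  shows "B \<in> noise_sets"
  using assms emeasure_mono[of B A lborel] by (auto simp: noise_sets_def intro: le_less_trans)

lemma noise_sets_empty [simp]: "{} \<in> noise_sets"
  by (simp add: noise_sets_def)

lemma noise_sets_Un:
  assumes "A \<in> noise_sets" "B \<in> noise_sets"
  shows "A \<union> B \<in> noise_sets"
  using assms emeasure_subadditive[of A lborel B]
  by (auto simp: noise_sets_def intro: order.strict_trans1)

lemma noise_sets_Int: "A \<in> noise_sets \<Longrightarrow> B \<in> noise_sets \<Longrightarrow> A \<inter> B \<in> noise_sets"
  by (rule noise_sets_subset[of A]) (auto dest: noise_setsD)

lemma noise_sets_Diff: "A \<in> noise_sets \<Longrightarrow> B \<in> noise_sets \<Longrightarrow> A - B \<in> noise_sets"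
  by (rule noise_sets_subset[of A]) (auto dest: noise_setsD)

lemma noise_sets_rectangle:
  assumes "0 \<le> a" "a \<le> b" "A \<in> sets borel" "emeasure lborel A < \<infinity>"
  shows "{a<..b} \<times> A \<in> noise_sets"
proof -
  have "{a<..b} \<times> A \<in> sets (borel \<Otimes>\<^sub>M borel)"
    using assms by simp
  then have 1: "{a<..b} \<times> A \<in> sets (borel :: (real \<times> real) measure)"
    unfolding borel_prod .
  have "emeasure (lborel \<Otimes>\<^sub>M lborel) ({a<..b} \<times> A) = emeasure lborel {a<..b} * emeasure lborel A"
    using assms by (intro lborel.emeasure_pair_measure_Times) auto
  then have "emeasure lborel ({a<..b} \<times> A) < \<infinity>"
    using assms by (simp add: lborel_prod ennreal_mult_less_top)
  with 1 assms show ?thesis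
    by (auto simp: noise_sets_def)
qed

locale white_noise_space =
  fixes M :: "'a measure" and W :: "(real \<times> real) set \<Rightarrow> 'a \<Rightarrow> real"
  assumes white_noise: "white_noise M W"

sublocale white_noise_space \<subseteq> prob_space M
  using white_noise by (simp add: white_noise_def)

context white_noise_space
begin

lemma noise_measurable [measurable (raw)]: "A \<in> noise_sets \<Longrightarrow> W A \<in> borel_measurable M"
  and noise_distr: "A \<in> noise_sets \<Longrightarrow> distr M borel (W A) = centred_normal (measure lborel A)"
  and noise_indep: "finite F \<Longrightarrow> F \<subseteq> noise_sets \<Longrightarrow> disjoint F \<Longrightarrow> indep_vars (\<lambda>_. borel) W F"
  and noise_Un: "A \<in> noise_sets \<Longrightarrow> B \<in> noise_sets \<Longrightarrow> A \<inter> B = {} \<Longrightarrow>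
        AE \<omega> in M. W (A \<union> B) \<omega> = W A \<omega> + W B \<omega>"
  using white_noise by (auto simp: white_noise_def)

lemma noise_null:
  assumes "A \<in> noise_sets" "measure lborel A = 0"
  shows "AE \<omega> in M. W A \<omega> = 0"
proof -
  have "distr M borel (W A) = return borel 0"
    using noise_distr[OF assms(1)] assms(2) by (simp add: centred_normal_def)
  moreover have "AE x in return borel (0::real). x = 0"
    by (subst AE_return) auto
  ultimately have "AE x in distr M borel (W A). x = 0"
    by metis
  then show ?thesis
    by (subst (asm) AE_distr_iff) (use assms in auto)
qed

lemma noise_moments:
  assumes A: "A \<in> noise_sets"
  shows "integrable M (W A)" "expectation (W A) = 0"
    "integrable M (\<lambda>\<omega>. (W A \<omega>)\<^sup>2)" "expectation (\<lambda>\<omega>. (W A \<omega>)\<^sup>2) = measure lborel A"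
proof -
  note [measurable] = noise_measurable[OF A]
  define v where "v = measure lborel A"
  have "integrable M (W A) \<and> expectation (W A) = 0 \<and>
    integrable M (\<lambda>\<omega>. (W A \<omega>)\<^sup>2) \<and> expectation (\<lambda>\<omega>. (W A \<omega>)\<^sup>2) = v"
  proof (cases "v = 0")
    case True
    have AE0: "AE \<omega> in M. W A \<omega> = 0"
      using noise_null[OF A] True by (simp add: v_def)
    have "has_bochner_integral M (W A) 0"
      by (rule has_bochner_integralI_AE[OF has_bochner_integral_zero]) (use AE0 in auto)
    moreover have "has_bochner_integral M (\<lambda>\<omega>. (W A \<omega>)\<^sup>2) 0"
      by (rule has_bochner_integralI_AE[OF has_bochner_integral_zero]) (use AE0 in auto)
    ultimately show ?thesis
      using True by (auto simp: has_bochner_integral_iff)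
  next
    case False
    then have v: "0 < v"
      by (simp add: v_def zero_less_measure_iff order_less_le)
    then have s: "0 < sqrt v" by simp
    have D: "distributed M lborel (W A) (\<lambda>x. ennreal (normal_density 0 (sqrt v) x))"
      unfolding distributed_def using noise_distr[OF A] False
      by (auto simp: centred_normal_def v_def cong: distr_cong)
    have i1: "integrable M (W A)"
      using integrable_normal_moment_nz_1[OF s, of 0] distributed_integrable[OF D, of "\<lambda>x. x"]
      by simp
    have i2: "integrable M (\<lambda>\<omega>. (W A \<omega>)\<^sup>2)"
      using integrable_normal_moment[OF s, of 0 2] distributed_integrable[OF D, of "\<lambda>x. x\<^sup>2"]
      by simp
    have e1: "expectation (W A) = 0"
      by (rule normal_distributed_expectation[OF s D])
    have "expectation (\<lambda>\<omega>. (W A \<omega>)\<^sup>2) = v"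
      using normal_distributed_variance[OF s D] e1 v by simp
    with i1 i2 e1 show ?thesis by simp
  qed
  then show "integrable M (W A)" "expectation (W A) = 0"
    "integrable M (\<lambda>\<omega>. (W A \<omega>)\<^sup>2)" "expectation (\<lambda>\<omega>. (W A \<omega>)\<^sup>2) = measure lborel A"
    by (auto simp: v_def)
qed

section \<open>Additivity over finite families and independence for overlapping sets\<close>

lemma noise_Union:
  assumes "finite F" "F \<subseteq> noise_sets" "disjoint F"
  shows "\<Union>F \<in> noise_sets \<and> (AE \<omega> in M. W (\<Union>F) \<omega> = (\<Sum>A\<in>F. W A \<omega>))"
  using assms
proof (induction F)
  case empty
  then show ?case using noise_null[of "{}"] by simp
next
  case (insert A F)
  then have IH: "\<Union>F \<in> noise_sets" "AE \<omega> in M. W (\<Union>F) \<omega> = (\<Sum>A\<in>F. W A \<omega>)"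
    by (auto simp: disjoint_def)
  have "A \<inter> B = {}" if "B \<in> F" for B
    using insert.prems(2) insert.hyps(2) that disjointD[of "insert A F" A B] by auto
  then have "A \<inter> \<Union>F = {}" by blast
  then have "AE \<omega> in M. W (A \<union> \<Union>F) \<omega> = W A \<omega> + W (\<Union>F) \<omega>"
    using insert.prems IH by (intro noise_Un) auto
  with IH(2) have "AE \<omega> in M. W (\<Union>(insert A F)) \<omega> = (\<Sum>A\<in>insert A F. W A \<omega>)"
    by eventually_elim (use insert.hyps in simp)
  moreover have "\<Union>(insert A F) \<in> noise_sets"
    using insert.prems IH noise_sets_Un[of A "\<Union>F"] by simp
  ultimately show ?case by blast
qed

text \<open>\<open>\<A>\<close> consists of the atoms of the algebra generated by \<open>F\<close> inside \<open>\<Union>F\<close>.\<close>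

lemma noise_decompose:
  assumes "finite F" "F \<subseteq> noise_sets"
  obtains \<A> where "finite \<A>" "\<A> \<subseteq> noise_sets" "disjoint \<A>" "{} \<notin> \<A>" "\<Union>\<A> \<subseteq> \<Union>F"
    "\<And>A. A \<in> F \<Longrightarrow> AE \<omega> in M. W A \<omega> = (\<Sum>C\<in>{C\<in>\<A>. C \<subseteq> A}. W C \<omega>)"
proof -
  define atom where "atom x = {y. \<forall>A\<in>F. y \<in> A \<longleftrightarrow> x \<in> A}" for x
  \<comment> \<open>Only atoms inside \<open>\<Union>F\<close> are taken: the remaining one, its
    complement, has infinite measure and is no noise set.\<close>
  define \<A> where "\<A> = atom ` \<Union>F"
  have self: "x \<in> atom x" for x
    by (simp add: atom_def)
  have eq: "atom y = atom x" if "y \<in> atom x" for x y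
    using that by (auto simp: atom_def)
  have sub: "atom x \<subseteq> A" if "x \<in> A" "A \<in> F" for x A
    using that by (auto simp: atom_def)
  \<comment> \<open>Finiteness: an atom is determined by the subfamily of \<open>F\<close> whose
    members contain it.\<close>
  have "atom ` \<Union>F \<subseteq> (\<lambda>G. {y. \<forall>A\<in>F. y \<in> A \<longleftrightarrow> A \<in> G}) ` Pow F"
  proof
    fix C assume "C \<in> atom ` \<Union>F"
    then obtain x where "C = atom x" by auto
    then have "C = (\<lambda>G. {y. \<forall>A\<in>F. y \<in> A \<longleftrightarrow> A \<in> G}) {A\<in>F. x \<in> A}"
      by (auto simp: atom_def)
    then show "C \<in> (\<lambda>G. {y. \<forall>A\<in>F. y \<in> A \<longleftrightarrow> A \<in> G}) ` Pow F"
      by blast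
  qed
  then have fin: "finite \<A>"
    unfolding \<A>_def by (rule finite_subset) (use assms in auto)
  have "atom x \<in> noise_sets" if x: "x \<in> \<Union>F" for x
  proof -
    obtain A where A: "A \<in> F" "x \<in> A" using x by auto
    have "atom x = (\<Inter>B\<in>F. if x \<in> B then B else - B)"
      by (auto simp: atom_def split: if_splits)
    moreover have "(\<Inter>B\<in>F. if x \<in> B then B else - B) \<in> sets borel"
      by (rule sets.finite_INT) (use assms A noise_setsD(1) in auto)
    ultimately show ?thesis
      using A assms sub[of x A] noise_sets_subset[of A "atom x"] by auto
  qed
  then have noise: "\<A> \<subseteq> noise_sets"
    by (auto simp: \<A>_def)
  have disj: "disjoint \<A>"
    unfolding \<A>_def disjoint_def using eq by blast
  show thesis
  proof
    show "finite \<A>" "\<A> \<subseteq> noise_sets" "disjoint \<A>" by fact+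
    show "{} \<notin> \<A>" using self by (auto simp: \<A>_def)
    show "\<Union>\<A> \<subseteq> \<Union>F" unfolding \<A>_def using sub by blast
    fix A assume A: "A \<in> F"
    have "A = \<Union>{C\<in>\<A>. C \<subseteq> A}"
      using A self sub unfolding \<A>_def by blast
    moreover have "AE \<omega> in M. W (\<Union>{C\<in>\<A>. C \<subseteq> A}) \<omega> = (\<Sum>C\<in>{C\<in>\<A>. C \<subseteq> A}. W C \<omega>)"
      using fin noise disj by (intro noise_Union[THEN conjunct2]) (auto simp: disjoint_def)
    ultimately show "AE \<omega> in M. W A \<omega> = (\<Sum>C\<in>{C\<in>\<A>. C \<subseteq> A}. W C \<omega>)"
      by simp
  qed
qed

text \<open>The members of \<open>F\<close> may overlap, whereas \<open>white_noise\<close> grants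
  independence for disjoint families only. Each \<open>W A\<close> is almost surely a sum over
  atoms, and the atoms together with \<open>D\<close> form a disjoint family.\<close>

lemma noise_indep_rectangle:
  assumes F: "finite F" "F \<subseteq> noise_sets" and D: "D \<in> noise_sets" "D \<inter> \<Union>F = {}"
    and B: "\<And>A. A \<in> F \<Longrightarrow> B A \<in> sets borel" and C: "C \<in> sets borel"
  shows "prob {\<omega>\<in>space M. (\<forall>A\<in>F. W A \<omega> \<in> B A) \<and> W D \<omega> \<in> C} =
    prob {\<omega>\<in>space M. \<forall>A\<in>F. W A \<omega> \<in> B A} * prob {\<omega>\<in>space M. W D \<omega> \<in> C}"
proof -
  obtain \<A> where \<A>: "finite \<A>" "\<A> \<subseteq> noise_sets" "disjoint \<A>" "{} \<notin> \<A>"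
      "\<Union>\<A> \<subseteq> \<Union>F"
    and eq: "\<And>A. A \<in> F \<Longrightarrow> AE \<omega> in M. W A \<omega> = (\<Sum>C\<in>{C\<in>\<A>. C \<subseteq> A}. W C \<omega>)"
    using noise_decompose[OF F] by blast
  have dis: "E \<inter> D = {}" if "E \<in> \<A>" for E
    using \<A>(5) D(2) that by blast
  \<comment> \<open>An atom equal to \<open>D\<close> would be disjoint from itself, hence empty,
    and the empty set is not an atom.\<close>
  have D_notin: "D \<notin> \<A>"
    using dis[of D] \<A>(4) by auto
  have "disjoint (insert D \<A>)"
    using \<A>(3) dis by (auto simp: disjoint_def)
  then have ind: "indep_vars (\<lambda>_. borel) W (insert D \<A>)"
    using \<A> D by (intro noise_indep) auto
  have ind2: "indep_var (PiM \<A> (\<lambda>_. borel)) (\<lambda>\<omega>. \<lambda>i\<in>\<A>. W i \<omega>)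
      (PiM {D} (\<lambda>_. borel)) (\<lambda>\<omega>. \<lambda>i\<in>{D}. W i \<omega>)"
    using D_notin by (intro indep_var_restrict[OF ind]) auto
  define Q where "Q = {y\<in>space (PiM \<A> (\<lambda>_. borel :: real measure)).
    \<forall>A\<in>F. (\<Sum>C\<in>{C\<in>\<A>. C \<subseteq> A}. y C) \<in> B A}"
  have meas: "(\<lambda>y. \<Sum>C\<in>{C\<in>\<A>. C \<subseteq> A}. y C) \<in> borel_measurable (PiM \<A> (\<lambda>_. borel :: real measure))" for A
    by (intro borel_measurable_sum measurable_component_singleton) auto
  have Q: "Q \<in> sets (PiM \<A> (\<lambda>_. borel))"
    unfolding Q_def
  proof (intro sets.sets_Collect_finite_All F(1))
    fix A assume "A \<in> F"
    then show "{y \<in> space (PiM \<A> (\<lambda>_. borel :: real measure)). (\<Sum>C\<in>{C\<in>\<A>. C \<subseteq> A}. y C) \<in> B A}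
        \<in> sets (PiM \<A> (\<lambda>_. borel))"
      using measurable_sets[OF meas B, of A A] by (simp add: vimage_def Int_def conj_commute)
  qed
  define R where "R = {y\<in>space (PiM {D} (\<lambda>_. borel :: real measure)). y D \<in> C}"
  have R: "R \<in> sets (PiM {D} (\<lambda>_. borel))"
    unfolding R_def
    using measurable_sets[OF measurable_component_singleton[of D "{D}" "\<lambda>_. borel :: real measure"] C]
    by (simp add: vimage_def Int_def conj_commute)
  have in_space: "(\<lambda>i\<in>I. W i \<omega>) \<in> space (PiM I (\<lambda>_. borel :: real measure))" for I \<omega>
    by (simp add: space_PiM)
  have sum_eq: "(\<Sum>C\<in>{C\<in>\<A>. C \<subseteq> A}. (\<lambda>i\<in>\<A>. W i \<omega>) C) = (\<Sum>C\<in>{C\<in>\<A>. C \<subseteq> A}. W C \<omega>)" for A \<omega>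
    by (intro sum.cong) auto
  have Q_iff: "(\<lambda>i\<in>\<A>. W i \<omega>) \<in> Q \<longleftrightarrow> (\<forall>A\<in>F. (\<Sum>C\<in>{C\<in>\<A>. C \<subseteq> A}. W C \<omega>) \<in> B A)" for \<omega>
    unfolding Q_def using sum_eq by (simp add: in_space del: restrict_apply)
  have R_iff: "(\<lambda>i\<in>{D}. W i \<omega>) \<in> R \<longleftrightarrow> W D \<omega> \<in> C" for \<omega>
    unfolding R_def by (simp add: in_space)
  \<comment> \<open>Additivity of the noise holds only almost surely, so the two events agree up to
    a null set; their probabilities are compared, not the events themselves.\<close>
  have AE_Q: "AE \<omega> in M. (\<forall>A\<in>F. W A \<omega> \<in> B A) \<longleftrightarrow> (\<lambda>i\<in>\<A>. W i \<omega>) \<in> Q"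
  proof -
    have "AE \<omega> in M. \<forall>A\<in>F. W A \<omega> = (\<Sum>C\<in>{C\<in>\<A>. C \<subseteq> A}. W C \<omega>)"
      using eq F(1) by (intro AE_finite_allI)
    then show ?thesis
      by eventually_elim (simp add: Q_iff)
  qed
  have F_meas: "{\<omega>\<in>space M. \<forall>A\<in>F. W A \<omega> \<in> B A} \<in> events"
  proof (intro sets.sets_Collect_finite_All F(1))
    fix A assume "A \<in> F"
    then show "{\<omega> \<in> space M. W A \<omega> \<in> B A} \<in> events"
      using measurable_sets[OF noise_measurable B, of A A] F
      by (auto simp: vimage_def Int_def conj_commute)
  qed
  have D_meas: "{\<omega>\<in>space M. W D \<omega> \<in> C} \<in> events"
    using measurable_sets[OF noise_measurable C, of D] D(1)
    by (auto simp: vimage_def Int_def conj_commute)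
  have rvQ: "{\<omega>\<in>space M. (\<lambda>i\<in>\<A>. W i \<omega>) \<in> Q} \<in> events"
    using measurable_sets[OF indep_var_rv1[OF ind2] Q] by (simp add: vimage_def Int_def conj_commute)
  have "prob {\<omega>\<in>space M. (\<forall>A\<in>F. W A \<omega> \<in> B A) \<and> W D \<omega> \<in> C} =
    prob {\<omega>\<in>space M. (\<lambda>i\<in>\<A>. W i \<omega>) \<in> Q \<and> W D \<omega> \<in> C}"
  proof (rule finite_measure_eq_AE)
    show "AE \<omega> in M. \<omega> \<in> {\<omega>\<in>space M. (\<forall>A\<in>F. W A \<omega> \<in> B A) \<and> W D \<omega> \<in> C} \<longleftrightarrow>
       \<omega> \<in> {\<omega>\<in>space M. (\<lambda>i\<in>\<A>. W i \<omega>) \<in> Q \<and> W D \<omega> \<in> C}"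
      using AE_Q by eventually_elim auto
    show "{\<omega>\<in>space M. (\<forall>A\<in>F. W A \<omega> \<in> B A) \<and> W D \<omega> \<in> C} \<in> events"
      using sets.Int[OF F_meas D_meas] by (simp add: Int_def conj_ac cong: conj_cong)
    show "{\<omega>\<in>space M. (\<lambda>i\<in>\<A>. W i \<omega>) \<in> Q \<and> W D \<omega> \<in> C} \<in> events"
      using sets.Int[OF rvQ D_meas] by (simp add: Int_def conj_ac cong: conj_cong)
  qed
  also have "\<dots> = prob ((\<lambda>\<omega>. (\<lambda>i\<in>\<A>. W i \<omega>, \<lambda>i\<in>{D}. W i \<omega>)) -` (Q \<times> R) \<inter> space M)"
    using R_iff by (intro arg_cong[of _ _ prob]) auto
  also have "\<dots> = prob ((\<lambda>\<omega>. \<lambda>i\<in>\<A>. W i \<omega>) -` Q \<inter> space M) * prob ((\<lambda>\<omega>. \<lambda>i\<in>{D}. W i \<omega>) -` R \<inter> space M)"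
    by (rule indep_varD[OF ind2 Q R])
  also have "(\<lambda>\<omega>. \<lambda>i\<in>{D}. W i \<omega>) -` R \<inter> space M = {\<omega>\<in>space M. W D \<omega> \<in> C}"
    using R_iff by auto
  also have "prob ((\<lambda>\<omega>. \<lambda>i\<in>\<A>. W i \<omega>) -` Q \<inter> space M) = prob {\<omega>\<in>space M. \<forall>A\<in>F. W A \<omega> \<in> B A}"
  proof (rule finite_measure_eq_AE)
    show "AE \<omega> in M. \<omega> \<in> (\<lambda>\<omega>. \<lambda>i\<in>\<A>. W i \<omega>) -` Q \<inter> space M \<longleftrightarrow>
       \<omega> \<in> {\<omega>\<in>space M. \<forall>A\<in>F. W A \<omega> \<in> B A}"
      using AE_Q by eventually_elim auto
    show "(\<lambda>\<omega>. \<lambda>i\<in>\<A>. W i \<omega>) -` Q \<inter> space M \<in> events"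
      by (rule measurable_sets[OF indep_var_rv1[OF ind2] Q])
  qed (rule F_meas)
  finally show ?thesis .
qed

section \<open>The augmented filtration and its independence of later noise\<close>

lemma noise_filtration_generators:
  "{W A -` B \<inter> space M | A B. A \<in> noise_sets \<and> A \<subseteq> {0..t} \<times> UNIV \<and> B \<in> sets borel} \<union> null_sets M
    \<subseteq> events"
  by (auto intro: measurable_sets[OF noise_measurable])

lemma space_noise_filtration [simp]: "space (noise_filtration M W t) = space M"
  unfolding noise_filtration_def by (simp add: space_measure_of_conv)

lemma sets_noise_filtration:
  "sets (noise_filtration M W t) = sigma_sets (space M)
    ({W A -` B \<inter> space M | A B. A \<in> noise_sets \<and> A \<subseteq> {0..t} \<times> UNIV \<and> B \<in> sets borel} \<union> null_sets M)"
  unfolding noise_filtration_def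
  using noise_filtration_generators[of t] sets.space_closed by (intro sets_measure_of) blast

lemma noise_filtration_subset: "sets (noise_filtration M W t) \<subseteq> events"
  unfolding sets_noise_filtration by (intro sets.sigma_sets_subset noise_filtration_generators)

lemma noise_filtration_measurable:
  "X \<in> borel_measurable (noise_filtration M W t) \<Longrightarrow> X \<in> borel_measurable M"
  using noise_filtration_subset by (auto simp: measurable_def)

lemma noise_filtration_mono:
  assumes "s \<le> t"
  shows "sets (noise_filtration M W s) \<subseteq> sets (noise_filtration M W t)"
proof -
  have "{0..s} \<times> UNIV \<subseteq> {0..t} \<times> (UNIV :: real set)"
    using assms by auto
  then show ?thesis
    unfolding sets_noise_filtration by (intro sigma_sets_mono') blast
qed

lemma noise_filtration_measurable_mono:
  "s \<le> t \<Longrightarrow> X \<in> borel_measurable (noise_filtration M W s) \<Longrightarrow> X \<in> borel_measurable (noise_filtration M W t)"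
  using noise_filtration_mono[of s t] by (auto simp: measurable_def)

lemma noise_adapted:
  assumes "A \<in> noise_sets" "A \<subseteq> {0..t} \<times> UNIV"
  shows "W A \<in> borel_measurable (noise_filtration M W t)"
proof (rule measurableI)
  fix B :: "real set" assume "B \<in> sets borel"
  with assms have "W A -` B \<inter> space M \<in> {W A -` B \<inter> space M | A B.
      A \<in> noise_sets \<and> A \<subseteq> {0..t} \<times> UNIV \<and> B \<in> sets borel} \<union> null_sets M"
    by blast
  then show "W A -` B \<inter> space (noise_filtration M W t) \<in> sets (noise_filtration M W t)"
    unfolding sets_noise_filtration space_noise_filtration by (rule sigma_sets.Basic)
qed simp

text \<open>A pi-system argument: on cylinder events the product formula is
  \<open>noise_indep_rectangle\<close>, and both generating classes are stable under intersection,
  so it extends to the generated sigma-algebras.\<close>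

lemma noise_filtration_indep:
  assumes D: "D \<in> noise_sets" "D \<subseteq> {t<..} \<times> UNIV"
  shows "indep_set (sets (noise_filtration M W t))
    (sigma_sets (space M) {W D -` C \<inter> space M | C. C \<in> sets borel})"
proof -
  \<comment> \<open>the cylinder events, enlarged by null sets so that they contain all generators of the filtration\<close>
  define cyl where "cyl P F B \<longleftrightarrow> finite F \<and> F \<subseteq> noise_sets \<and> \<Union>F \<subseteq> {0..t} \<times> UNIV \<and>
    (\<forall>A\<in>F. B A \<in> sets (borel :: real measure)) \<and> (AE \<omega> in M. \<omega> \<in> P \<longleftrightarrow> (\<forall>A\<in>F. W A \<omega> \<in> B A))" for P F B
  define G where "G = {P\<in>events. \<exists>F B. cyl P F B}"
  have Int: "Int_stable G"
  proof (rule Int_stableI)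
    fix P1 P2 assume "P1 \<in> G" "P2 \<in> G"
    then obtain F1 B1 F2 B2 where c: "P1 \<in> events" "cyl P1 F1 B1" "P2 \<in> events" "cyl P2 F2 B2"
      by (auto simp: G_def)
    \<comment> \<open>\<open>UNIV\<close> is the vacuous constraint for a set that occurs in only
      one of the two cylinders.\<close>
    define B where "B A = (if A \<in> F1 then B1 A else UNIV) \<inter> (if A \<in> F2 then B2 A else UNIV)" for A
    have 1: "AE \<omega> in M. \<omega> \<in> P1 \<longleftrightarrow> (\<forall>A\<in>F1. W A \<omega> \<in> B1 A)"
      and 2: "AE \<omega> in M. \<omega> \<in> P2 \<longleftrightarrow> (\<forall>A\<in>F2. W A \<omega> \<in> B2 A)"
      using c by (auto simp: cyl_def)
    have "AE \<omega> in M. \<omega> \<in> P1 \<inter> P2 \<longleftrightarrow> (\<forall>A\<in>F1 \<union> F2. W A \<omega> \<in> B A)"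
      using 1 2 by eventually_elim (auto simp: B_def)
    then have "cyl (P1 \<inter> P2) (F1 \<union> F2) B"
      using c unfolding cyl_def B_def by auto
    then show "P1 \<inter> P2 \<in> G"
      using c by (auto simp: G_def)
  qed
  have gen: "{W A -` B \<inter> space M | A B. A \<in> noise_sets \<and> A \<subseteq> {0..t} \<times> UNIV \<and> B \<in> sets borel} \<union> null_sets M
    \<subseteq> G"
  proof safe
    fix A and B :: "real set" assume "A \<in> noise_sets" "A \<subseteq> {0..t} \<times> UNIV" "B \<in> sets borel"
    then have "cyl (W A -` B \<inter> space M) {A} (\<lambda>_. B)" "W A -` B \<inter> space M \<in> events"
      by (auto simp: cyl_def intro!: AE_I2 measurable_sets[OF noise_measurable])
    then show "W A -` B \<inter> space M \<in> G"
      by (auto simp: G_def)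
  next
    fix N assume N: "N \<in> null_sets M"
    \<comment> \<open>A null set agrees almost surely with the impossible event that
      \<open>W {}\<close> lies in the empty set.\<close>
    then have "cyl N {{}} (\<lambda>_. {})"
      using AE_not_in[OF N] by (auto simp: cyl_def)
    then show "N \<in> G"
      using N by (auto simp: G_def)
  qed
  have Int': "Int_stable {W D -` C \<inter> space M | C. C \<in> sets borel}"
  proof (rule Int_stableI)
    fix P Q assume "P \<in> {W D -` C \<inter> space M | C. C \<in> sets borel}"
      "Q \<in> {W D -` C \<inter> space M | C. C \<in> sets borel}"
    then obtain C C' where "P = W D -` C \<inter> space M" "Q = W D -` C' \<inter> space M"
      "C \<in> sets borel" "C' \<in> sets borel" by blast
    then have "P \<inter> Q = W D -` (C \<inter> C') \<inter> space M" "C \<inter> C' \<in> sets borel" by auto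
    then show "P \<inter> Q \<in> {W D -` C \<inter> space M | C. C \<in> sets borel}" by blast
  qed
  have "indep_set G {W D -` C \<inter> space M | C. C \<in> sets borel}"
    unfolding indep_sets2_eq
  proof (intro conjI ballI)
    show "G \<subseteq> events" by (auto simp: G_def)
    show "{W D -` C \<inter> space M |C. C \<in> sets borel} \<subseteq> events"
      using D by (auto intro: measurable_sets[OF noise_measurable])
    fix P Q assume "P \<in> G" "Q \<in> {W D -` C \<inter> space M |C. C \<in> sets borel}"
    then obtain F B C where P: "P \<in> events" "cyl P F B" and C: "C \<in> sets borel"
      and Q: "Q = W D -` C \<inter> space M"
      by (auto simp: G_def)
    have AE: "AE \<omega> in M. \<omega> \<in> P \<longleftrightarrow> (\<forall>A\<in>F. W A \<omega> \<in> B A)"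
      using P by (simp add: cyl_def)
    have dis: "D \<inter> \<Union>F = {}"
      using P D(2) unfolding cyl_def by fastforce
    have Q_ev: "Q \<in> events"
      unfolding Q using D C by (auto intro: measurable_sets[OF noise_measurable])
    have F_meas: "{\<omega>\<in>space M. \<forall>A\<in>F. W A \<omega> \<in> B A} \<in> events"
    proof (intro sets.sets_Collect_finite_All)
      fix A assume "A \<in> F"
      then show "{\<omega> \<in> space M. W A \<omega> \<in> B A} \<in> events"
        using measurable_sets[OF noise_measurable, of A "B A"] P
        by (auto simp: cyl_def vimage_def Int_def conj_commute)
    qed (use P in \<open>simp add: cyl_def\<close>)
    have eqQ: "{\<omega>\<in>space M. (\<forall>A\<in>F. W A \<omega> \<in> B A) \<and> W D \<omega> \<in> C} = {\<omega>\<in>space M. \<forall>A\<in>F. W A \<omega> \<in> B A} \<inter> Q"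
      by (auto simp: Q)
    have "prob (P \<inter> Q) = prob {\<omega>\<in>space M. (\<forall>A\<in>F. W A \<omega> \<in> B A) \<and> W D \<omega> \<in> C}"
    proof (rule finite_measure_eq_AE)
      show "AE \<omega> in M. \<omega> \<in> P \<inter> Q \<longleftrightarrow> \<omega> \<in> {\<omega>\<in>space M. (\<forall>A\<in>F. W A \<omega> \<in> B A) \<and> W D \<omega> \<in> C}"
        using AE by eventually_elim (auto simp: Q)
    qed (use P Q_ev F_meas eqQ in auto)
    also have "\<dots> = prob {\<omega>\<in>space M. \<forall>A\<in>F. W A \<omega> \<in> B A} * prob {\<omega>\<in>space M. W D \<omega> \<in> C}"
      using P D dis C by (intro noise_indep_rectangle) (auto simp: cyl_def)
    also have "{\<omega>\<in>space M. W D \<omega> \<in> C} = Q"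
      by (auto simp: Q)
    also have "prob {\<omega>\<in>space M. \<forall>A\<in>F. W A \<omega> \<in> B A} = prob P"
    proof (rule finite_measure_eq_AE)
      show "AE \<omega> in M. \<omega> \<in> {\<omega>\<in>space M. \<forall>A\<in>F. W A \<omega> \<in> B A} \<longleftrightarrow> \<omega> \<in> P"
        using AE AE_space by eventually_elim auto
    qed (use P F_meas in auto)
    finally show "prob (P \<inter> Q) = prob P * prob Q" .
  qed
  from indep_set_sigma_sets[OF this Int Int']
  have ind: "indep_set (sigma_sets (space M) G) (sigma_sets (space M) {W D -` C \<inter> space M | C. C \<in> sets borel})" .
  have sub: "sets (noise_filtration M W t) \<subseteq> sigma_sets (space M) G"
    unfolding sets_noise_filtration using gen by (rule sigma_sets_mono')
  show ?thesis
    by (rule indep_set_mono_left[OF ind sub])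
qed

lemma noise_filtration_indep_var:
  assumes "D \<in> noise_sets" "D \<subseteq> {t<..} \<times> UNIV" "Y \<in> borel_measurable (noise_filtration M W t)"
  shows "indep_var borel Y borel (W D)"
proof -
  have "sigma_sets (space M) {Y -` A \<inter> space M | A. A \<in> sets borel} \<subseteq> sets (noise_filtration M W t)"
  proof -
    have "{Y -` A \<inter> space M | A. A \<in> sets borel} \<subseteq> sets (noise_filtration M W t)"
      using measurable_sets[OF assms(3)] by auto
    then show ?thesis
      using sets.sigma_sets_subset[of _ "noise_filtration M W t"] by simp
  qed
  with noise_filtration_indep[OF assms(1,2)]
  have "indep_set (sigma_sets (space M) {Y -` A \<inter> space M | A. A \<in> sets borel})
      (sigma_sets (space M) {W D -` C \<inter> space M | C. C \<in> sets borel})"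
    by (rule indep_set_mono_left)
  then show ?thesis
    unfolding indep_var_eq
    using noise_filtration_measurable[OF assms(3)] noise_measurable[OF assms(1)] by (intro conjI)
qed

section \<open>The isometry\<close>

lemma noise_mult_integrable:
  assumes "A \<in> noise_sets" "B \<in> noise_sets"
  shows "integrable M (\<lambda>\<omega>. W A \<omega> * W B \<omega>)"
proof (rule Bochner_Integration.integrable_bound)
  show "integrable M (\<lambda>\<omega>. (W A \<omega>)\<^sup>2 + (W B \<omega>)\<^sup>2)"
    using assms by (intro Bochner_Integration.integrable_add noise_moments)
  show "(\<lambda>\<omega>. W A \<omega> * W B \<omega>) \<in> borel_measurable M"
    using assms by (intro borel_measurable_times noise_measurable)
  have "\<bar>x * y\<bar> \<le> x\<^sup>2 + y\<^sup>2" for x y :: real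
  proof -
    have "2 * (\<bar>x\<bar> * \<bar>y\<bar>) \<le> x\<^sup>2 + y\<^sup>2"
      using sum_squares_bound[of "\<bar>x\<bar>" "\<bar>y\<bar>"] by (simp add: mult.assoc)
    moreover have "0 \<le> \<bar>x\<bar> * \<bar>y\<bar>" by simp
    ultimately show ?thesis unfolding abs_mult by linarith
  qed
  then show "AE \<omega> in M. norm (W A \<omega> * W B \<omega>) \<le> norm ((W A \<omega>)\<^sup>2 + (W B \<omega>)\<^sup>2)"
    by (auto simp: abs_of_nonneg)
qed

text \<open>\<open>Y\<close> is only assumed integrable because the covariance computation applies
  this to a weight that contains an earlier noise value, which need not be bounded.\<close>

lemma expectation_future_noise:
  assumes "D \<in> noise_sets" "D \<subseteq> {t<..} \<times> UNIV" "Y \<in> borel_measurable (noise_filtration M W t)"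
    and Y: "integrable M Y"
  shows "integrable M (\<lambda>\<omega>. Y \<omega> * W D \<omega>)" "expectation (\<lambda>\<omega>. Y \<omega> * W D \<omega>) = 0"
    "expectation (\<lambda>\<omega>. Y \<omega> * (W D \<omega>)\<^sup>2) = expectation Y * measure lborel D"
proof -
  note ind = noise_filtration_indep_var[OF assms(1-3)]
  show "integrable M (\<lambda>\<omega>. Y \<omega> * W D \<omega>)"
    by (rule indep_var_integrable[OF ind Y noise_moments(1)[OF assms(1)]])
  show "expectation (\<lambda>\<omega>. Y \<omega> * W D \<omega>) = 0"
    using indep_var_lebesgue_integral[OF ind Y noise_moments(1)[OF assms(1)]] noise_moments(2)[OF assms(1)]
    by simp
  have "indep_var borel ((\<lambda>x. x) \<circ> Y) borel ((\<lambda>x. x\<^sup>2) \<circ> W D)"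
    by (rule indep_var_compose[OF ind]) auto
  then have ind2: "indep_var borel Y borel (\<lambda>\<omega>. (W D \<omega>)\<^sup>2)"
    by (simp add: comp_def)
  show "expectation (\<lambda>\<omega>. Y \<omega> * (W D \<omega>)\<^sup>2) = expectation Y * measure lborel D"
    using indep_var_lebesgue_integral[OF ind2 Y noise_moments(3)[OF assms(1)]] noise_moments(4)[OF assms(1)]
    by simp
qed

text \<open>Independence of \<open>Y\<close> has been shown for one noise value at a time, not for a
  pair. Disjoint sets are therefore treated by polarisation, comparing the squares for
  \<open>A\<close>, \<open>B\<close> and \<open>A \<union> B\<close>; the general case splits
  \<open>D\<close> and \<open>E\<close> along their intersection.\<close>

lemma expectation_future_noise_mult:
  assumes D: "D \<in> noise_sets" "D \<subseteq> {t<..} \<times> UNIV" and E: "E \<in> noise_sets" "E \<subseteq> {t<..} \<times> UNIV"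
    and Y: "Y \<in> borel_measurable (noise_filtration M W t)" "bounded (Y ` space M)"
  shows "integrable M (\<lambda>\<omega>. Y \<omega> * (W D \<omega> * W E \<omega>))"
    "expectation (\<lambda>\<omega>. Y \<omega> * (W D \<omega> * W E \<omega>)) = expectation Y * measure lborel (D \<inter> E)"
proof -
  note [measurable] = noise_filtration_measurable[OF Y(1)]
  have int: "integrable M (\<lambda>\<omega>. Y \<omega> * (W A \<omega> * W B \<omega>))" if "A \<in> noise_sets" "B \<in> noise_sets" for A B
    using that Y by (intro bounded_mult_integrable noise_mult_integrable) auto
  have intY: "integrable M Y"
    using bounded_mult_integrable[of Y M "\<lambda>_. 1"] Y by simp
  have sq: "expectation (\<lambda>\<omega>. Y \<omega> * (W A \<omega> * W A \<omega>)) = expectation Y * measure lborel A"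
    if "A \<in> noise_sets" "A \<subseteq> {t<..} \<times> UNIV" for A
    using expectation_future_noise(3)[OF that Y(1) intY] by (simp add: power2_eq_square)
  have disj: "expectation (\<lambda>\<omega>. Y \<omega> * (W A \<omega> * W B \<omega>)) = 0"
    if A: "A \<in> noise_sets" "A \<subseteq> {t<..} \<times> UNIV" and B: "B \<in> noise_sets" "B \<subseteq> {t<..} \<times> UNIV"
      and AB: "A \<inter> B = {}" for A B
  proof -
    have "expectation (\<lambda>\<omega>. Y \<omega> * (W (A \<union> B) \<omega> * W (A \<union> B) \<omega>)) =
      expectation (\<lambda>\<omega>. Y \<omega> * (W A \<omega> * W A \<omega>) + Y \<omega> * (W B \<omega> * W B \<omega>) + 2 * (Y \<omega> * (W A \<omega> * W B \<omega>)))"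
    proof (rule Bochner_Integration.integral_cong_AE)
      show "AE \<omega> in M. Y \<omega> * (W (A \<union> B) \<omega> * W (A \<union> B) \<omega>) =
        Y \<omega> * (W A \<omega> * W A \<omega>) + Y \<omega> * (W B \<omega> * W B \<omega>) + 2 * (Y \<omega> * (W A \<omega> * W B \<omega>))"
        using noise_Un[OF A(1) B(1) AB] by eventually_elim (simp add: algebra_simps)
    qed (use A B noise_sets_Un in \<open>auto intro!: borel_measurable_times borel_measurable_add noise_measurable
            noise_filtration_measurable[OF Y(1)]\<close>)
    also have "\<dots> = expectation (\<lambda>\<omega>. Y \<omega> * (W A \<omega> * W A \<omega>)) + expectation (\<lambda>\<omega>. Y \<omega> * (W B \<omega> * W B \<omega>))
        + 2 * expectation (\<lambda>\<omega>. Y \<omega> * (W A \<omega> * W B \<omega>))"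
      using int[OF A(1) A(1)] int[OF B(1) B(1)] int[OF A(1) B(1)] by simp
    also have "measure lborel (A \<union> B) = measure lborel A + measure lborel B"
      using A B AB noise_setsD(1) noise_setsD(3)[OF A(1)] noise_setsD(3)[OF B(1)]
      by (intro measure_Union) (auto simp: less_top)
    then have "expectation (\<lambda>\<omega>. Y \<omega> * (W (A \<union> B) \<omega> * W (A \<union> B) \<omega>)) =
      expectation Y * measure lborel A + expectation Y * measure lborel B"
      using A B by (subst sq) (auto simp: noise_sets_Un algebra_simps)
    finally show ?thesis
      using sq[OF A] sq[OF B] by simp
  qed
  let ?C = "D \<inter> E" and ?D = "D - E" and ?E = "E - D"
  have N: "?C \<in> noise_sets" "?D \<in> noise_sets" "?E \<in> noise_sets"
    using D E by (auto intro: noise_sets_Int noise_sets_Diff)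
  have sub: "?C \<subseteq> {t<..} \<times> UNIV" "?D \<subseteq> {t<..} \<times> UNIV" "?E \<subseteq> {t<..} \<times> UNIV"
    using D E by blast+
  have "AE \<omega> in M. W (?C \<union> ?D) \<omega> = W ?C \<omega> + W ?D \<omega>" "AE \<omega> in M. W (?C \<union> ?E) \<omega> = W ?C \<omega> + W ?E \<omega>"
    using N by (intro noise_Un; blast)+
  moreover have "?C \<union> ?D = D" "?C \<union> ?E = E" by blast+
  ultimately have ae: "AE \<omega> in M. W D \<omega> = W ?C \<omega> + W ?D \<omega>" "AE \<omega> in M. W E \<omega> = W ?C \<omega> + W ?E \<omega>"
    by simp_all
  have "expectation (\<lambda>\<omega>. Y \<omega> * (W D \<omega> * W E \<omega>)) =
    expectation (\<lambda>\<omega>. Y \<omega> * (W ?C \<omega> * W ?C \<omega>) + Y \<omega> * (W ?C \<omega> * W ?E \<omega>) +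
      Y \<omega> * (W ?D \<omega> * W ?C \<omega>) + Y \<omega> * (W ?D \<omega> * W ?E \<omega>))"
  proof (rule Bochner_Integration.integral_cong_AE)
    show "AE \<omega> in M. Y \<omega> * (W D \<omega> * W E \<omega>) = Y \<omega> * (W ?C \<omega> * W ?C \<omega>) + Y \<omega> * (W ?C \<omega> * W ?E \<omega>) +
      Y \<omega> * (W ?D \<omega> * W ?C \<omega>) + Y \<omega> * (W ?D \<omega> * W ?E \<omega>)"
      using ae by eventually_elim (simp add: algebra_simps)
  qed (use D E N in \<open>auto intro!: borel_measurable_times borel_measurable_add noise_measurable
            noise_filtration_measurable[OF Y(1)]\<close>)
  also have "\<dots> = expectation (\<lambda>\<omega>. Y \<omega> * (W ?C \<omega> * W ?C \<omega>)) + expectation (\<lambda>\<omega>. Y \<omega> * (W ?C \<omega> * W ?E \<omega>)) +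
      expectation (\<lambda>\<omega>. Y \<omega> * (W ?D \<omega> * W ?C \<omega>)) + expectation (\<lambda>\<omega>. Y \<omega> * (W ?D \<omega> * W ?E \<omega>))"
    using int[OF N(1) N(1)] int[OF N(1) N(3)] int[OF N(2) N(1)] int[OF N(2) N(3)] by simp
  also have "\<dots> = expectation Y * measure lborel ?C"
  proof -
    have "?C \<inter> ?E = {}" "?D \<inter> ?C = {}" "?D \<inter> ?E = {}" by blast+
    then show ?thesis
      using sq[OF N(1) sub(1)] disj[OF N(1) sub(1) N(3) sub(3)] disj[OF N(2) sub(2) N(1) sub(1)]
        disj[OF N(2) sub(2) N(3) sub(3)] by simp
  qed
  finally show "expectation (\<lambda>\<omega>. Y \<omega> * (W D \<omega> * W E \<omega>)) = expectation Y * measure lborel (D \<inter> E)" .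
  show "integrable M (\<lambda>\<omega>. Y \<omega> * (W D \<omega> * W E \<omega>))"
    by (rule int[OF D(1) E(1)])
qed

section \<open>Covariances of elementary integrals and the isometry for simple integrands\<close>

definition step_integrand :: "real \<Rightarrow> real \<Rightarrow> real set \<Rightarrow> ('a \<Rightarrow> real) \<Rightarrow> bool" where
  "step_integrand a b A X \<longleftrightarrow> 0 \<le> a \<and> a \<le> b \<and> A \<in> sets borel \<and> emeasure lborel A < \<infinity> \<and>
        X \<in> borel_measurable (noise_filtration M W a) \<and> bounded (X ` space M)"

lemma step_integrandD:
  assumes "step_integrand a b A X"
  shows "{a<..b} \<times> A \<in> noise_sets" "X \<in> borel_measurable M" "bounded (X ` space M)"
    "integrable M (\<lambda>\<omega>. X \<omega> * W ({a<..b} \<times> A) \<omega>)"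
    "expectation (\<lambda>\<omega>. X \<omega> * W ({a<..b} \<times> A) \<omega>) = 0"
proof -
  show N: "{a<..b} \<times> A \<in> noise_sets" "X \<in> borel_measurable M" "bounded (X ` space M)"
    using assms by (auto simp: step_integrand_def noise_sets_rectangle noise_filtration_measurable)
  have "integrable M X"
    using bounded_mult_integrable[of X M "\<lambda>_. 1"] N by simp
  then show "integrable M (\<lambda>\<omega>. X \<omega> * W ({a<..b} \<times> A) \<omega>)"
    "expectation (\<lambda>\<omega>. X \<omega> * W ({a<..b} \<times> A) \<omega>) = 0"
    using N assms by (auto simp: step_integrand_def intro!: expectation_future_noise[of _ a])
qed

text \<open>By symmetry \<open>a \<le> a'\<close>. Cutting the first rectangle at time
  \<open>a'\<close> leaves an early piece, whose noise is known at \<open>a'\<close> and joins the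
  weight of a mean-zero increment, and a late piece, for which both noise values come after
  \<open>a'\<close>.\<close>

lemma step_integrand_covariance:
  assumes "step_integrand a b A X" "step_integrand a' b' A' X'"
  shows "integrable M (\<lambda>\<omega>. (X \<omega> * W ({a<..b} \<times> A) \<omega>) * (X' \<omega> * W ({a'<..b'} \<times> A') \<omega>)) \<and>
    expectation (\<lambda>\<omega>. (X \<omega> * W ({a<..b} \<times> A) \<omega>) * (X' \<omega> * W ({a'<..b'} \<times> A') \<omega>)) =
      expectation (\<lambda>\<omega>. X \<omega> * X' \<omega>) * measure lborel (({a<..b} \<times> A) \<inter> ({a'<..b'} \<times> A'))"
  using assms
proof (induction a a' arbitrary: b A X b' A' X' rule: linorder_wlog)
  case (sym a a')
  from sym(1)[OF sym(3,2)] show ?case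
    by (simp add: mult.commute Int_commute)
next
  case (le a a')
  let ?B = "{a<..b} \<times> A" and ?B' = "{a'<..b'} \<times> A'"
  \<comment> \<open>\<open>min\<close> and \<open>max\<close> cover the case
    \<open>b \<le> a'\<close> as well, in which \<open>?B2\<close> is empty and \<open>?B1\<close>
    is all of \<open>?B\<close>.\<close>
  let ?B1 = "{a<..min b a'} \<times> A" and ?B2 = "{a'<..max a' b} \<times> A"
  note D = step_integrandD[OF le(2)] and D' = step_integrandD[OF le(3)]
  have B1: "?B1 \<in> noise_sets" and B2: "?B2 \<in> noise_sets"
    using le by (auto simp: step_integrand_def intro!: noise_sets_rectangle)
  have "?B = ?B1 \<union> ?B2" "?B1 \<inter> ?B2 = {}"
    using le(1) by auto
  then have ae: "AE \<omega> in M. W ?B \<omega> = W ?B1 \<omega> + W ?B2 \<omega>"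
    using noise_Un[OF B1 B2] by simp
  have XX': "(\<lambda>\<omega>. X \<omega> * X' \<omega>) \<in> borel_measurable (noise_filtration M W a')"
    using le noise_filtration_measurable_mono[OF le(1)] unfolding step_integrand_def
    by (intro borel_measurable_times) auto
  have bdd: "bounded ((\<lambda>\<omega>. X \<omega> * X' \<omega>) ` space M)"
    using D D' by (intro bounded_mult)
  have WB1: "W ?B1 \<in> borel_measurable (noise_filtration M W a')"
    using B1 le by (intro noise_adapted) (auto simp: step_integrand_def)
  have Z: "(\<lambda>\<omega>. X \<omega> * X' \<omega> * W ?B1 \<omega>) \<in> borel_measurable (noise_filtration M W a')"
    by (intro borel_measurable_times[OF XX' WB1])
  have Z_int: "integrable M (\<lambda>\<omega>. X \<omega> * X' \<omega> * W ?B1 \<omega>)"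
    using B1 bdd by (intro bounded_mult_integrable noise_filtration_measurable[OF XX'] noise_moments)
  note past = expectation_future_noise(1,2)[OF D'(1) _ Z Z_int]
  note future = expectation_future_noise_mult[OF B2 _ D'(1) _ XX' bdd]
  have sub: "?B' \<subseteq> {a'<..} \<times> UNIV" "?B2 \<subseteq> {a'<..} \<times> UNIV" by auto
  have ae': "AE \<omega> in M. (X \<omega> * W ?B \<omega>) * (X' \<omega> * W ?B' \<omega>) =
    X \<omega> * X' \<omega> * W ?B1 \<omega> * W ?B' \<omega> + X \<omega> * X' \<omega> * (W ?B2 \<omega> * W ?B' \<omega>)"
    using ae by eventually_elim (simp add: algebra_simps)
  have meas: "(\<lambda>\<omega>. (X \<omega> * W ?B \<omega>) * (X' \<omega> * W ?B' \<omega>)) \<in> borel_measurable M"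
    using D D' by (intro borel_measurable_times noise_measurable)
  have "has_bochner_integral M (\<lambda>\<omega>. X \<omega> * X' \<omega> * W ?B1 \<omega> * W ?B' \<omega> + X \<omega> * X' \<omega> * (W ?B2 \<omega> * W ?B' \<omega>))
    (0 + expectation (\<lambda>\<omega>. X \<omega> * X' \<omega>) * measure lborel (?B2 \<inter> ?B'))"
    using past[OF sub(1)] future[OF sub(2,1)]
    by (intro has_bochner_integral_add) (auto simp: has_bochner_integral_iff)
  moreover have "?B2 \<inter> ?B' = ?B \<inter> ?B'"
    using le(1) by auto
  ultimately have "has_bochner_integral M (\<lambda>\<omega>. (X \<omega> * W ?B \<omega>) * (X' \<omega> * W ?B' \<omega>))
    (expectation (\<lambda>\<omega>. X \<omega> * X' \<omega>) * measure lborel (?B \<inter> ?B'))"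
    using has_bochner_integral_cong_AE[OF meas _ ae'] by (auto simp: has_bochner_integral_iff)
  then show ?case
    by (simp add: has_bochner_integral_iff)
qed

sublocale space_time: pair_sigma_finite M "lborel :: (real \<times> real) measure"
  by unfold_locales

lemma has_bochner_integral_mult_indicator:
  fixes B :: "(real \<times> real) set"
  assumes Y: "integrable M Y" and B: "B \<in> sets borel" "emeasure lborel B < \<infinity>"
  shows "has_bochner_integral (M \<Otimes>\<^sub>M lborel) (\<lambda>(\<omega>, z). Y \<omega> * indicator B z)
    (expectation Y * measure lborel B)"
proof -
  have [measurable]: "B \<in> sets lborel" using B by simp
  have [measurable]: "Y \<in> borel_measurable M" using Y by auto
  have B_int: "has_bochner_integral lborel (indicator B :: _ \<Rightarrow> real) (measure lborel B)"
    using B by (intro has_bochner_integral_real_indicator) auto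
  have inner: "(LINT z|lborel. c * indicator B z) = c * measure lborel B" for c :: real
    using B_int by (simp add: has_bochner_integral_iff)
  have int: "integrable (M \<Otimes>\<^sub>M lborel) (\<lambda>(\<omega>, z). Y \<omega> * indicator B z)"
  proof (rule space_time.Fubini_integrable)
    show "(\<lambda>(\<omega>, z). Y \<omega> * indicator B z) \<in> borel_measurable (M \<Otimes>\<^sub>M lborel)"
      by measurable
    show "integrable M (\<lambda>\<omega>. LINT z|lborel. norm (case (\<omega>, z) of (\<omega>, z) \<Rightarrow> Y \<omega> * indicator B z))"
      using Y inner by (simp add: abs_mult)
    show "AE \<omega> in M. integrable lborel (\<lambda>z. case (\<omega>, z) of (\<omega>, z) \<Rightarrow> Y \<omega> * indicator B z)"
      using B_int by (simp add: has_bochner_integral_iff)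
  qed
  moreover have "integral\<^sup>L (M \<Otimes>\<^sub>M lborel) (\<lambda>(\<omega>, z). Y \<omega> * indicator B z) = expectation Y * measure lborel B"
    using space_time.integral_fst'[OF int] inner by simp
  ultimately show ?thesis
    by (simp add: has_bochner_integral_iff)
qed

text \<open>Both sides expand into the same double sum of \<open>c i j\<close>, so the rectangles
  need not be made disjoint. The deterministic summand \<open>g\<close> adds just its square since
  the simple integral has mean zero.\<close>

lemma simple_isometry:
  assumes S: "simple_integrand M W S"
  shows "(\<integral>\<^sup>+ \<omega>. ennreal ((g + simple_integral W S \<omega>)\<^sup>2) \<partial>M) =
    ennreal (g\<^sup>2) + (\<integral>\<^sup>+ (\<omega>, s, y). ennreal ((simple_fun S \<omega> s y)\<^sup>2) \<partial>(M \<Otimes>\<^sub>M lborel))"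
    and "simple_integral W S \<in> borel_measurable M"
    and "(\<lambda>(\<omega>, s, y). simple_fun S \<omega> s y) \<in> borel_measurable (M \<Otimes>\<^sub>M lborel)"
proof -
  define X where "X i = snd (snd (snd (S ! i)))" for i
  define B where "B i = {fst (S ! i)<..fst (snd (S ! i))} \<times> fst (snd (snd (S ! i)))" for i
  define c where "c i j = expectation (\<lambda>\<omega>. X i \<omega> * X j \<omega>) * measure lborel (B i \<inter> B j)" for i j
  have step: "step_integrand (fst (S ! i)) (fst (snd (S ! i))) (fst (snd (snd (S ! i)))) (X i)"
    if "i < length S" for i
    using S nth_mem[OF that] by (auto simp: simple_integrand_def step_integrand_def X_def)
  have D: "B i \<in> noise_sets" "X i \<in> borel_measurable M" "bounded (X i ` space M)"
    "integrable M (\<lambda>\<omega>. X i \<omega> * W (B i) \<omega>)" "expectation (\<lambda>\<omega>. X i \<omega> * W (B i) \<omega>) = 0"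
    if "i < length S" for i
    using step_integrandD[OF step[OF that]] by (auto simp: B_def)
  have int: "simple_integral W S \<omega> = (\<Sum>i<length S. X i \<omega> * W (B i) \<omega>)" for \<omega>
    unfolding simple_integral_def by (subst sum_list_case4) (simp add: X_def B_def)
  have fn: "simple_fun S \<omega> s y = (\<Sum>i<length S. X i \<omega> * indicator (B i) (s, y))" for \<omega> s y
    unfolding simple_fun_def by (subst sum_list_case4) (simp add: X_def B_def indicator_times mult.assoc)
  have fn': "(\<lambda>(\<omega>, s, y). simple_fun S \<omega> s y) = (\<lambda>(\<omega>, z). \<Sum>i<length S. X i \<omega> * indicator (B i) z)"
    by (auto simp: fn)
  show meas_int: "simple_integral W S \<in> borel_measurable M"
    unfolding int using D by (intro borel_measurable_sum borel_measurable_times noise_measurable) auto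
  have ind_meas: "(\<lambda>p. X i (fst p) * indicator (B i) (snd p)) \<in> borel_measurable (M \<Otimes>\<^sub>M lborel)"
    if "i < length S" for i
  proof -
    have [measurable]: "X i \<in> borel_measurable M" "B i \<in> sets lborel"
      using D[OF that] noise_setsD by auto
    show ?thesis by measurable
  qed
  show "(\<lambda>(\<omega>, s, y). simple_fun S \<omega> s y) \<in> borel_measurable (M \<Otimes>\<^sub>M lborel)"
    unfolding fn' case_prod_beta using ind_meas by (intro borel_measurable_sum) auto
  have sq_int: "has_bochner_integral M (\<lambda>\<omega>. (simple_integral W S \<omega>)\<^sup>2) (\<Sum>i<length S. \<Sum>j<length S. c i j)"
    unfolding int power2_eq_square sum_product
    using step_integrand_covariance[OF step step]
    by (intro has_bochner_integral_sum) (auto simp: has_bochner_integral_iff c_def B_def)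
  have lin_int: "has_bochner_integral M (simple_integral W S) (\<Sum>i<length S. 0)"
    unfolding int using D by (intro has_bochner_integral_sum) (auto simp: has_bochner_integral_iff)
  have "has_bochner_integral M (\<lambda>\<omega>. g\<^sup>2 + 2 * g * simple_integral W S \<omega> + (simple_integral W S \<omega>)\<^sup>2)
    (g\<^sup>2 + 2 * g * 0 + (\<Sum>i<length S. \<Sum>j<length S. c i j))"
    using lin_int sq_int by (intro has_bochner_integral_add has_bochner_integral_mult_right)
      (auto simp: has_bochner_integral_iff prob_space)
  then have total: "has_bochner_integral M (\<lambda>\<omega>. (g + simple_integral W S \<omega>)\<^sup>2)
    (g\<^sup>2 + (\<Sum>i<length S. \<Sum>j<length S. c i j))"
    by (simp add: power2_sum algebra_simps)
  have fn_sq: "has_bochner_integral (M \<Otimes>\<^sub>M lborel) (\<lambda>(\<omega>, s, y). (simple_fun S \<omega> s y)\<^sup>2)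
    (\<Sum>i<length S. \<Sum>j<length S. c i j)"
  proof -
    have "has_bochner_integral (M \<Otimes>\<^sub>M lborel)
      (\<lambda>p. \<Sum>i<length S. \<Sum>j<length S. case p of (\<omega>, z) \<Rightarrow> X i \<omega> * X j \<omega> * indicator (B i \<inter> B j) z)
      (\<Sum>i<length S. \<Sum>j<length S. c i j)"
    proof (intro has_bochner_integral_sum)
      fix i j assume "i \<in> {..<length S}" "j \<in> {..<length S}"
      then have ij: "i < length S" "j < length S" by auto
      have "integrable M (\<lambda>\<omega>. X i \<omega> * X j \<omega> * 1)"
        using D[OF ij(1)] D[OF ij(2)] by (intro bounded_mult_integrable bounded_mult) auto
      moreover have "B i \<inter> B j \<in> noise_sets"
        using D[OF ij(1)] D[OF ij(2)] noise_sets_Int by blast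
      ultimately show "has_bochner_integral (M \<Otimes>\<^sub>M lborel)
        (\<lambda>p. case p of (\<omega>, z) \<Rightarrow> X i \<omega> * X j \<omega> * indicator (B i \<inter> B j) z) (c i j)"
        unfolding c_def using noise_setsD[of "B i \<inter> B j"]
        by (intro has_bochner_integral_mult_indicator) auto
    qed
    also have "(\<lambda>p. \<Sum>i<length S. \<Sum>j<length S. case p of (\<omega>, z) \<Rightarrow> X i \<omega> * X j \<omega> * indicator (B i \<inter> B j) z) =
      (\<lambda>(\<omega>, s, y). (simple_fun S \<omega> s y)\<^sup>2)"
    proof (rule ext)
      fix p :: "'a \<times> real \<times> real"
      obtain \<omega> s y where p: "p = (\<omega>, s, y)" by (cases p) auto
      show "(\<Sum>i<length S. \<Sum>j<length S. case p of (\<omega>, z) \<Rightarrow> X i \<omega> * X j \<omega> * indicator (B i \<inter> B j) z) =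
        (case p of (\<omega>, s, y) \<Rightarrow> (simple_fun S \<omega> s y)\<^sup>2)"
        unfolding p prod.case fn power2_eq_square sum_product
        by (intro sum.cong refl) (simp only: indicator_inter_arith ac_simps)
    qed
    finally show ?thesis .
  qed
  \<comment> \<open>The sum is a second moment; its sign is needed because \<open>ennreal\<close> is
    additive only on nonnegative reals.\<close>
  have nonneg: "0 \<le> (\<Sum>i<length S. \<Sum>j<length S. c i j)"
    by (subst has_bochner_integral_integral_eq[OF sq_int, symmetric]) simp
  have "(\<integral>\<^sup>+ \<omega>. ennreal ((g + simple_integral W S \<omega>)\<^sup>2) \<partial>M) = ennreal (g\<^sup>2 + (\<Sum>i<length S. \<Sum>j<length S. c i j))"
    using total by (subst nn_integral_eq_integral) (auto simp: has_bochner_integral_iff)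
  also have "\<dots> = ennreal (g\<^sup>2) + ennreal (\<Sum>i<length S. \<Sum>j<length S. c i j)"
    using nonneg by (intro ennreal_plus) auto
  also have "ennreal (\<Sum>i<length S. \<Sum>j<length S. c i j) =
    (\<integral>\<^sup>+ p. ennreal ((\<lambda>(\<omega>, s, y). (simple_fun S \<omega> s y)\<^sup>2) p) \<partial>(M \<Otimes>\<^sub>M lborel))"
    using fn_sq by (subst nn_integral_eq_integral) (auto simp: has_bochner_integral_iff)
  also have "\<dots> = (\<integral>\<^sup>+ (\<omega>, s, y). ennreal ((simple_fun S \<omega> s y)\<^sup>2) \<partial>(M \<Otimes>\<^sub>M lborel))"
    by (intro nn_integral_cong) auto
  finally show "(\<integral>\<^sup>+ \<omega>. ennreal ((g + simple_integral W S \<omega>)\<^sup>2) \<partial>M) =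
    ennreal (g\<^sup>2) + (\<integral>\<^sup>+ (\<omega>, s, y). ennreal ((simple_fun S \<omega> s y)\<^sup>2) \<partial>(M \<Otimes>\<^sub>M lborel))" .
qed

text \<open>
  The factor 4 comes from using \<open>a\<^sup>2 \<le> 2 b\<^sup>2 + 2 (a - b)\<^sup>2\<close> twice when passing to the limit; the sharp
  constant is 1.
\<close>

lemma walsh_integral_lower_bound:
  assumes "has_walsh_integral M W \<Phi> I"
  shows "ennreal (g\<^sup>2) + (\<integral>\<^sup>+ (\<omega>, s, y). ennreal ((\<Phi> \<omega> s y)\<^sup>2) \<partial>(M \<Otimes>\<^sub>M lborel))
    \<le> 4 * (\<integral>\<^sup>+ \<omega>. ennreal ((g + I \<omega>)\<^sup>2) \<partial>M)"
proof -
  from assms obtain S where S: "\<And>n. simple_integrand M W (S n)"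
    and d: "(\<lambda>n. \<integral>\<^sup>+ (\<omega>, s, y). ennreal ((simple_fun (S n) \<omega> s y - \<Phi> \<omega> s y)\<^sup>2) \<partial>(M \<Otimes>\<^sub>M lborel)) \<longlonglongrightarrow> 0"
    and e: "(\<lambda>n. \<integral>\<^sup>+ \<omega>. ennreal ((simple_integral W (S n) \<omega> - I \<omega>)\<^sup>2) \<partial>M) \<longlonglongrightarrow> 0"
    and [measurable]: "(\<lambda>(\<omega>, s, y). \<Phi> \<omega> s y) \<in> borel_measurable (M \<Otimes>\<^sub>M lborel)" "I \<in> borel_measurable M"
    unfolding has_walsh_integral_def by blast
  note [measurable] = simple_isometry(2,3)[OF S]
  define d' where "d' n = (\<integral>\<^sup>+ (\<omega>, s, y). ennreal ((simple_fun (S n) \<omega> s y - \<Phi> \<omega> s y)\<^sup>2) \<partial>(M \<Otimes>\<^sub>M lborel))" for n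
  define e' where "e' n = (\<integral>\<^sup>+ \<omega>. ennreal ((simple_integral W (S n) \<omega> - I \<omega>)\<^sup>2) \<partial>M)" for n
  define F where "F p = (case p of (\<omega>, s, y) \<Rightarrow> \<Phi> \<omega> s y)" for p
  define T where "T n p = (case p of (\<omega>, s, y) \<Rightarrow> simple_fun (S n) \<omega> s y)" for n p
  have [measurable]: "F \<in> borel_measurable (M \<Otimes>\<^sub>M lborel)" "T n \<in> borel_measurable (M \<Otimes>\<^sub>M lborel)" for n
    unfolding F_def T_def by measurable
  let ?L = "\<integral>\<^sup>+ p. ennreal ((F p)\<^sup>2) \<partial>(M \<Otimes>\<^sub>M lborel)"
  let ?R = "\<integral>\<^sup>+ \<omega>. ennreal ((g + I \<omega>)\<^sup>2) \<partial>M"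
  have d'_eq: "d' n = (\<integral>\<^sup>+ p. ennreal ((T n p - F p)\<^sup>2) \<partial>(M \<Otimes>\<^sub>M lborel))" for n
    unfolding d'_def F_def T_def by (intro nn_integral_cong) auto
  have "ennreal (g\<^sup>2) + ?L \<le> 4 * ?R + (4 * e' n + 2 * d' n)" for n
  proof -
    let ?I = "simple_integral W (S n)"
    have "?L \<le> (\<integral>\<^sup>+ p. 2 * ennreal ((T n p)\<^sup>2) + 2 * ennreal ((T n p - F p)\<^sup>2) \<partial>(M \<Otimes>\<^sub>M lborel))"
      by (intro nn_integral_mono ennreal_sq_le)
    also have "\<dots> = 2 * (\<integral>\<^sup>+ p. ennreal ((T n p)\<^sup>2) \<partial>(M \<Otimes>\<^sub>M lborel)) + 2 * d' n"
      unfolding d'_eq by (simp add: nn_integral_add nn_integral_cmult)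
    finally have 1: "?L \<le> 2 * (\<integral>\<^sup>+ p. ennreal ((T n p)\<^sup>2) \<partial>(M \<Otimes>\<^sub>M lborel)) + 2 * d' n" .
    have "(\<integral>\<^sup>+ p. ennreal ((T n p)\<^sup>2) \<partial>(M \<Otimes>\<^sub>M lborel)) =
      (\<integral>\<^sup>+ (\<omega>, s, y). ennreal ((simple_fun (S n) \<omega> s y)\<^sup>2) \<partial>(M \<Otimes>\<^sub>M lborel))"
      unfolding T_def by (intro nn_integral_cong) auto
    then have 2: "(\<integral>\<^sup>+ \<omega>. ennreal ((g + ?I \<omega>)\<^sup>2) \<partial>M) = ennreal (g\<^sup>2) + (\<integral>\<^sup>+ p. ennreal ((T n p)\<^sup>2) \<partial>(M \<Otimes>\<^sub>M lborel))"
      using simple_isometry(1)[OF S] by simp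
    have "(\<integral>\<^sup>+ \<omega>. ennreal ((g + ?I \<omega>)\<^sup>2) \<partial>M) \<le>
      (\<integral>\<^sup>+ \<omega>. 2 * ennreal ((g + I \<omega>)\<^sup>2) + 2 * ennreal ((?I \<omega> - I \<omega>)\<^sup>2) \<partial>M)"
    proof (intro nn_integral_mono)
      fix \<omega>
      show "ennreal ((g + ?I \<omega>)\<^sup>2) \<le> 2 * ennreal ((g + I \<omega>)\<^sup>2) + 2 * ennreal ((?I \<omega> - I \<omega>)\<^sup>2)"
        using ennreal_sq_le[of "g + ?I \<omega>" "g + I \<omega>"] by (simp add: power2_commute)
    qed
    also have "\<dots> = 2 * ?R + 2 * e' n"
      unfolding e'_def by (simp add: nn_integral_add nn_integral_cmult)
    finally have 3: "(\<integral>\<^sup>+ \<omega>. ennreal ((g + ?I \<omega>)\<^sup>2) \<partial>M) \<le> 2 * ?R + 2 * e' n" .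
    \<comment> \<open>Doubling \<open>g\<^sup>2\<close> as well gives exactly twice the right-hand
      side of the isometry.\<close>
    have "ennreal (g\<^sup>2) + ?L \<le> 2 * ennreal (g\<^sup>2) + (2 * (\<integral>\<^sup>+ p. ennreal ((T n p)\<^sup>2) \<partial>(M \<Otimes>\<^sub>M lborel)) + 2 * d' n)"
      using 1 by (intro add_mono) (auto simp: mult_2)
    also have "\<dots> = 2 * (\<integral>\<^sup>+ \<omega>. ennreal ((g + ?I \<omega>)\<^sup>2) \<partial>M) + 2 * d' n"
      unfolding 2 by (simp add: distrib_left add.assoc)
    also have "\<dots> \<le> 2 * (2 * ?R + 2 * e' n) + 2 * d' n"
      using 3 by (intro add_mono mult_left_mono) auto
    also have "\<dots> = 4 * ?R + (4 * e' n + 2 * d' n)"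
      by (simp add: distrib_left add.assoc mult.assoc[symmetric])
    finally show ?thesis .
  qed
  moreover have "(\<lambda>n. 4 * ?R + (4 * e' n + 2 * d' n)) \<longlonglongrightarrow> 4 * ?R + (4 * 0 + 2 * 0)"
    using d e unfolding d'_def e'_def by (intro tendsto_add tendsto_const ennreal_tendsto_cmult) auto
  ultimately have "ennreal (g\<^sup>2) + ?L \<le> 4 * ?R + (4 * 0 + 2 * 0)"
    by (intro LIMSEQ_le_const) auto
  moreover have "?L = (\<integral>\<^sup>+ (\<omega>, s, y). ennreal ((\<Phi> \<omega> s y)\<^sup>2) \<partial>(M \<Otimes>\<^sub>M lborel))"
    unfolding F_def by (intro nn_integral_cong) auto
  ultimately show ?thesis by simp
qed

end

section \<open>Lower bounds for the stable kernel\<close>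

locale stable_kernel =
  fixes \<alpha> :: real and p :: "real \<Rightarrow> real \<Rightarrow> real"
  assumes index_gt: "1 < \<alpha>" and kernel: "stable_heat_kernel \<alpha> p"
begin

abbreviation law :: "real \<Rightarrow> real measure" where
  "law t \<equiv> density lborel (\<lambda>x. ennreal (p t x))"

lemma
  assumes "0 < t"
  shows kernel_continuous: "continuous_on UNIV (p t)" and kernel_nonneg [simp]: "0 \<le> p t x"
    and kernel_prob_space: "prob_space (law t)"
    and kernel_char: "char (law t) \<xi> = complex_of_real (exp (- t * \<bar>\<xi>\<bar> powr \<alpha>))"
  using kernel assms unfolding stable_heat_kernel_def by blast+

lemma kernel_measurable [measurable (raw)]: "0 < t \<Longrightarrow> p t \<in> borel_measurable borel"
  using kernel_continuous by (rule borel_measurable_continuous_onI)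

lemma law_real_distribution: "0 < t \<Longrightarrow> real_distribution (law t)"
  using kernel_prob_space[of t] by (simp add: real_distribution_def real_distribution_axioms_def)

lemma kernel_integral:
  assumes t: "0 < t"
  shows "integrable lborel (p t)" "integral\<^sup>L lborel (p t) = 1"
proof -
  interpret prob_space "law t" by (rule kernel_prob_space[OF t])
  have [measurable]: "p t \<in> borel_measurable borel" by (rule kernel_measurable[OF t])
  have "(\<integral>\<^sup>+ x. ennreal (p t x) \<partial>lborel) = ennreal 1"
    using emeasure_space_1 by (simp add: emeasure_density)
  then have "has_bochner_integral lborel (p t) 1"
    using t by (intro has_bochner_integral_nn_integral) auto
  then show "integrable lborel (p t)" "integral\<^sup>L lborel (p t) = 1"
    by (simp_all add: has_bochner_integral_iff)
qed

text \<open>Both sides equal the double integral of \<open>exp (\<i> r x z)\<close>.\<close>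

lemma kernel_parseval:
  "(LINT x|law 1. exp (- (r * x)\<^sup>2 / 2)) = (LINT z|std_normal_distribution. exp (- (\<bar>r * z\<bar> powr \<alpha>)))"
proof -
  interpret L: real_distribution "law 1" by (rule law_real_distribution) simp
  interpret N: real_distribution std_normal_distribution by (rule real_dist_normal_dist)
  interpret LN: pair_prob_space "law 1" std_normal_distribution ..
  have int: "integrable (law 1 \<Otimes>\<^sub>M std_normal_distribution) (\<lambda>(x, z). iexp (r * x * z))"
  proof (rule LN.P.integrable_const_bound[where B = 1])
    show "(\<lambda>(x, z). iexp (r * x * z)) \<in> borel_measurable (law 1 \<Otimes>\<^sub>M std_normal_distribution)"
      by (simp add: split_beta' cong: measurable_cong_sets sets_pair_measure_cong) measurable
  qed auto
  have "(CLINT x|law 1. CLINT z|std_normal_distribution. iexp (r * x * z)) =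
    (CLINT z|std_normal_distribution. CLINT x|law 1. iexp (r * x * z))"
    using LN.Fubini_integral[OF int] by simp
  moreover have "(CLINT z|std_normal_distribution. iexp (r * x * z)) = complex_of_real (exp (- (r * x)\<^sup>2 / 2))" for x
    using fun_cong[OF char_std_normal_distribution, of "r * x"] by (simp add: char_def)
  moreover have "(CLINT x|law 1. iexp (r * x * z)) = complex_of_real (exp (- (\<bar>r * z\<bar> powr \<alpha>)))" for z
    using kernel_char[of 1 "r * z"] by (simp add: char_def mult_ac)
  ultimately show ?thesis
    by (simp add: integral_complex_of_real)
qed

text \<open>Testing against a Gaussian of width \<open>1 / r\<close> takes the place of Fourier
  inversion. By \<open>kernel_parseval\<close> the Gaussian average of \<open>p 1\<close> is at
  least \<open>b / r\<close>. If \<open>p 1 0 = 0\<close>, the part near the origin contributes at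
  most \<open>b / (2 * r)\<close> by continuity, and the rest has a Gaussian tail in
  \<open>r\<close>: a contradiction for large \<open>r\<close>.\<close>

lemma kernel_origin_pos: "0 < p 1 0"
proof (rule ccontr)
  assume "\<not> 0 < p 1 0"
  then have p0: "p 1 0 = 0"
    using kernel_nonneg[of 1 0] by linarith
  interpret L: real_distribution "law 1" by (rule law_real_distribution) simp
  interpret N: real_distribution std_normal_distribution by (rule real_dist_normal_dist)
  have pm [measurable]: "p 1 \<in> borel_measurable borel" by (rule kernel_measurable) simp
  \<comment> \<open>On \<bar>z\<bar> \<le> 1 / r, an interval of length 2 / r, the normal density is
    at least its value at 1 and the exponential is at least \<open>exp (-1)\<close>.\<close>
  define b where "b = 2 * exp (-1) * std_normal_density 1"
  have b: "0 < b"
    by (simp add: b_def normal_density_pos)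
  \<comment> \<open>Chosen so that \<epsilon> times the Gaussian integral
    \<open>sqrt (2 * pi) / r\<close> is half of \<open>b / r\<close>.\<close>
  define \<epsilon> where "\<epsilon> = b / (2 * sqrt (2 * pi))"
  have \<epsilon>: "0 < \<epsilon>" using b by (simp add: \<epsilon>_def)
  have "isCont (p 1) 0"
    using kernel_continuous[of 1] by (simp add: continuous_on_eq_continuous_at)
  then obtain \<eta> where \<eta>: "0 < \<eta>" "\<And>x. \<bar>x\<bar> < \<eta> \<Longrightarrow> \<bar>p 1 x\<bar> < \<epsilon>"
    using \<epsilon> p0 unfolding continuous_at_eps_delta by (auto simp: dist_real_def)
  have main: "b / 2 \<le> r * exp (- (r * \<eta>)\<^sup>2 / 2)" if r: "1 \<le> r" for r
  proof -
    have lower: "b / r \<le> (LINT z|std_normal_distribution. exp (- (\<bar>r * z\<bar> powr \<alpha>)))"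
    proof -
      let ?J = "{-1/r..1/r}"
      have "std_normal_density 1 * (2 / r) \<le> N.prob ?J"
      proof -
        have "ennreal (std_normal_density 1 * (2 / r)) = (\<integral>\<^sup>+ z. ennreal (std_normal_density 1) * indicator ?J z \<partial>lborel)"
          using r by (simp add: nn_integral_cmult_indicator ennreal_mult'[symmetric])
        also have "\<dots> \<le> (\<integral>\<^sup>+ z. ennreal (std_normal_density z) * indicator ?J z \<partial>lborel)"
        proof (intro nn_integral_mono)
          fix z :: real
          show "ennreal (std_normal_density 1) * indicator ?J z \<le> ennreal (std_normal_density z) * indicator ?J z"
          proof (cases "z \<in> ?J")
            case True
            have "1 / r \<le> 1" using r by simp
            then have "\<bar>z\<bar> \<le> 1" using True by auto
            then have "z\<^sup>2 \<le> 1" by (simp add: abs_square_le_1)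
            then show ?thesis
              using True by (auto simp: std_normal_density_def intro!: ennreal_leI divide_right_mono)
          qed simp
        qed
        also have "\<dots> = ennreal (N.prob ?J)"
          by (simp add: N.emeasure_eq_measure[symmetric] emeasure_density)
        finally show ?thesis
          by (subst (asm) ennreal_le_iff) auto
      qed
      then have "b / r \<le> exp (-1) * N.prob ?J"
        using mult_left_mono[of "std_normal_density 1 * (2 / r)" "N.prob ?J" "exp (-1)"]
        by (simp add: b_def mult_ac)
      also have "\<dots> = (LINT z|std_normal_distribution. exp (-1) * indicator ?J z)"
        by simp
      also have "\<dots> \<le> (LINT z|std_normal_distribution. exp (- (\<bar>r * z\<bar> powr \<alpha>)))"
      proof (intro integral_mono)
        show "integrable std_normal_distribution (\<lambda>z. exp (-1) * indicat_real ?J z)"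
          by (rule N.integrable_const_bound[where B = 1]) (auto simp: indicator_def)
        show "integrable std_normal_distribution (\<lambda>z. exp (- (\<bar>r * z\<bar> powr \<alpha>)))"
          by (rule N.integrable_const_bound[where B = 1]) auto
        fix z
        show "exp (-1) * indicat_real ?J z \<le> exp (- (\<bar>r * z\<bar> powr \<alpha>))"
        proof (cases "z \<in> ?J")
          case True
          have "\<bar>z\<bar> \<le> 1 / r" using True by auto
          then have "\<bar>r * z\<bar> \<le> 1" using r by (simp add: abs_mult field_simps)
          then have "\<bar>r * z\<bar> powr \<alpha> \<le> 1"
            using index_gt by (intro powr_le1) auto
          then show ?thesis using True by simp
        qed simp
      qed
      finally show ?thesis .
    qed
    have upper: "(LINT x|law 1. exp (- (r * x)\<^sup>2 / 2)) \<le> \<epsilon> * sqrt (2 * pi) / r + exp (- (r * \<eta>)\<^sup>2 / 2)"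
    proof -
      have gauss: "has_bochner_integral lborel (\<lambda>x. exp (- (r * x)\<^sup>2 / 2)) (sqrt (2 * pi) / r)"
      proof -
        have "(\<lambda>x. exp (- (r * x)\<^sup>2 / 2)) = (\<lambda>x. (sqrt (2 * pi) / r) * normal_density 0 (1 / r) x)"
          using r by (auto simp: normal_density_def power_mult_distrib power_divide real_sqrt_divide field_simps)
        moreover have "has_bochner_integral lborel (\<lambda>x. (sqrt (2 * pi) / r) * normal_density 0 (1 / r) x)
            ((sqrt (2 * pi) / r) * 1)"
          using r by (intro has_bochner_integral_mult_right) (auto simp: has_bochner_integral_iff)
        ultimately show ?thesis by simp
      qed
      have "(LINT x|law 1. exp (- (r * x)\<^sup>2 / 2)) = (LINT x|lborel. p 1 x * exp (- (r * x)\<^sup>2 / 2))"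
        by (subst integral_density) auto
      also have "\<dots> \<le> (LINT x|lborel. \<epsilon> * exp (- (r * x)\<^sup>2 / 2) + exp (- (r * \<eta>)\<^sup>2 / 2) * p 1 x)"
      proof (rule integral_mono)
        show "integrable lborel (\<lambda>x. p 1 x * exp (- (r * x)\<^sup>2 / 2))"
          by (rule Bochner_Integration.integrable_bound[OF kernel_integral(1)[of 1]]) (auto intro!: mult_left_le)
        show "integrable lborel (\<lambda>x. \<epsilon> * exp (- (r * x)\<^sup>2 / 2) + exp (- (r * \<eta>)\<^sup>2 / 2) * p 1 x)"
          using gauss kernel_integral(1)[of 1] by (simp add: has_bochner_integral_iff)
        fix x
        show "p 1 x * exp (- (r * x)\<^sup>2 / 2) \<le> \<epsilon> * exp (- (r * x)\<^sup>2 / 2) + exp (- (r * \<eta>)\<^sup>2 / 2) * p 1 x"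
        proof (cases "\<bar>x\<bar> < \<eta>")
          case True
          then have "p 1 x * exp (- (r * x)\<^sup>2 / 2) \<le> \<epsilon> * exp (- (r * x)\<^sup>2 / 2)"
            using \<eta>(2)[of x] by (intro mult_right_mono) auto
          moreover have "0 \<le> exp (- (r * \<eta>)\<^sup>2 / 2) * p 1 x" by simp
          ultimately show ?thesis by linarith
        next
          case False
          then have "\<bar>r * \<eta>\<bar> \<le> \<bar>r * x\<bar>"
            unfolding abs_mult using \<eta>(1) by (intro mult_left_mono) auto
          then have "(r * \<eta>)\<^sup>2 \<le> (r * x)\<^sup>2"
            by (simp only: abs_le_square_iff)
          then have "p 1 x * exp (- (r * x)\<^sup>2 / 2) \<le> p 1 x * exp (- (r * \<eta>)\<^sup>2 / 2)"
            by (intro mult_left_mono) auto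
          then show ?thesis
            using \<epsilon> by (simp add: mult.commute add_increasing)
        qed
      qed
      also have "\<dots> = \<epsilon> * (sqrt (2 * pi) / r) + exp (- (r * \<eta>)\<^sup>2 / 2) * 1"
        using gauss kernel_integral[of 1] by (simp add: has_bochner_integral_iff)
      finally show ?thesis by simp
    qed
    have "b / r \<le> \<epsilon> * sqrt (2 * pi) / r + exp (- (r * \<eta>)\<^sup>2 / 2)"
      using lower upper kernel_parseval[of r] by linarith
    then have "b \<le> \<epsilon> * sqrt (2 * pi) + r * exp (- (r * \<eta>)\<^sup>2 / 2)"
      using r by (simp add: field_simps)
    moreover have "\<epsilon> * sqrt (2 * pi) = b / 2"
      by (simp add: \<epsilon>_def)
    ultimately show ?thesis by linarith
  qed
  have "((\<lambda>r. r * exp (- (r * \<eta>)\<^sup>2 / 2)) \<longlongrightarrow> 0) at_top"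
    using \<eta>(1) by real_asymp
  then have "\<forall>\<^sub>F r in at_top. r * exp (- (r * \<eta>)\<^sup>2 / 2) < b / 2"
    using b by (intro order_tendstoD) auto
  with eventually_ge_at_top[of 1] have "\<forall>\<^sub>F r::real in at_top. False"
    by eventually_elim (use main in fastforce)
  then show False by simp
qed

text \<open>The rescaled density has the same characteristic function, so Levy's uniqueness theorem
  identifies the laws; continuity of both densities removes the exceptional null set.\<close>

lemma kernel_scaling:
  assumes t: "0 < t"
  shows "p t x = t powr (- 1 / \<alpha>) * p 1 (t powr (- 1 / \<alpha>) * x)"
proof -
  define c where "c = t powr (- 1 / \<alpha>)"
  have c: "0 < c" using t by (simp add: c_def)
  have pm [measurable]: "p 1 \<in> borel_measurable borel" "p t \<in> borel_measurable borel"
    using t by (auto intro: kernel_measurable)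
  interpret L: real_distribution "law 1" by (rule law_real_distribution) simp
  let ?D = "density lborel (\<lambda>x. ennreal (c * p 1 (c * x)))"
  have eq: "?D = distr (law 1) borel (\<lambda>x. x / c)"
  proof -
    have "(\<lambda>x. x / c) = (*) (1 / c)"
      by auto
    then have dilate: "distr lborel borel (\<lambda>x. x / c) = density lborel (\<lambda>_. ennreal c)"
      using lborel_distr_mult[of "1 / c"] c by simp
    have "distr (law 1) borel (\<lambda>x. x / c) = density (distr lborel borel (\<lambda>x. x / c)) (\<lambda>x. ennreal (p 1 (c * x)))"
      using c by (subst density_distr) auto
    also have "\<dots> = density (density lborel (\<lambda>_. ennreal c)) (\<lambda>x. ennreal (p 1 (c * x)))"
      unfolding dilate ..
    also have "\<dots> = ?D"
      using c by (subst density_density_eq) (auto simp: ennreal_mult')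
    finally show ?thesis ..
  qed
  have "real_distribution ?D"
    unfolding eq by (simp add: real_distribution_def real_distribution_axioms_def L.prob_space_distr)
  moreover have "char (law t) = char ?D"
  proof
    fix \<xi>
    have "char ?D \<xi> = char (law 1) (\<xi> / c)"
      unfolding eq char_def by (subst integral_distr) auto
    also have "\<dots> = complex_of_real (exp (- (\<bar>\<xi> / c\<bar> powr \<alpha>)))"
      using kernel_char[of 1 "\<xi> / c"] by simp
    also have "\<bar>\<xi> / c\<bar> powr \<alpha> = t * \<bar>\<xi>\<bar> powr \<alpha>"
      using t index_gt by (simp add: c_def abs_divide abs_mult powr_mult powr_divide powr_powr powr_minus field_simps)
    finally show "char (law t) \<xi> = char ?D \<xi>"
      using kernel_char[OF t] by simp
  qed
  ultimately have "law t = ?D"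
    using law_real_distribution[OF t] by (intro Levy_uniqueness)
  then have "AE x in lborel. ennreal (p t x) = ennreal (c * p 1 (c * x))"
    by (subst (asm) sigma_finite_measure.density_unique_iff[OF sigma_finite_lborel]) auto
  then have "AE x in lborel. p t x = c * p 1 (c * x)"
    by eventually_elim (use t c in \<open>simp add: ennreal_inj\<close>)
  moreover have "continuous_on UNIV (\<lambda>x. c * p 1 (c * x))"
    by (intro continuous_intros continuous_on_compose2[OF kernel_continuous[of 1]]) auto
  ultimately have "p t = (\<lambda>x. c * p 1 (c * x))"
    using kernel_continuous[OF t] by (intro continuous_AE_eq)
  then show ?thesis
    by (simp add: c_def)
qed

text \<open>Scaling reduces this to time 1, where continuity keeps \<open>p 1\<close> above half its
  value at the origin. The cap \<open>\<eta> \<le> 1\<close> later ensures that \<open>reach\<close>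
  is at most 1/2 and \<open>spread_time\<close> at least 1.\<close>

lemma kernel_lower_bound:
  obtains \<kappa> \<eta> where "0 < \<kappa>" "0 < \<eta>" "\<eta> \<le> 1"
    "\<And>t w. 0 < t \<Longrightarrow> \<bar>w\<bar> \<le> \<eta> * t powr (1 / \<alpha>) \<Longrightarrow> \<kappa> * t powr (- 1 / \<alpha>) \<le> p t w"
proof -
  have "isCont (p 1) 0"
    using kernel_continuous[of 1] by (simp add: continuous_on_eq_continuous_at)
  then obtain d where d: "0 < d" "\<And>x. \<bar>x\<bar> < d \<Longrightarrow> \<bar>p 1 x - p 1 0\<bar> < p 1 0 / 2"
    using kernel_origin_pos unfolding continuous_at_eps_delta
    by (metis diff_zero dist_real_def half_gt_zero)
  define \<eta> where "\<eta> = min 1 (d / 2)"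
  show thesis
  proof
    show "0 < p 1 0 / 2" using kernel_origin_pos by simp
    show "0 < \<eta>" "\<eta> \<le> 1" using d by (auto simp: \<eta>_def)
    fix t w :: real assume t: "0 < t" and w: "\<bar>w\<bar> \<le> \<eta> * t powr (1 / \<alpha>)"
    have "\<bar>t powr (- 1 / \<alpha>) * w\<bar> = t powr (- 1 / \<alpha>) * \<bar>w\<bar>"
      by (simp add: abs_mult)
    also have "\<dots> \<le> t powr (- 1 / \<alpha>) * (\<eta> * t powr (1 / \<alpha>))"
      using w by (intro mult_left_mono) auto
    also have "\<dots> = \<eta>"
      using t by (simp add: powr_minus field_simps)
    also have "\<eta> < d" using d by (auto simp: \<eta>_def)
    finally have "p 1 0 / 2 \<le> p 1 (t powr (- 1 / \<alpha>) * w)"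
      using d(2)[of "t powr (- 1 / \<alpha>) * w"] by linarith
    then show "p 1 0 / 2 * t powr (- 1 / \<alpha>) \<le> p t w"
      unfolding kernel_scaling[OF t, of w]
      by (subst mult.commute[of "p 1 0 / 2"]) (rule mult_left_mono, simp_all)
  qed
qed

end

section \<open>Blow-up of supersolutions\<close>

text \<open>All that is kept of the equation is \<open>step\<close>: its 4 stems from the limit in
  the isometry, its \<open>A / 2\<close> from the moment inequality. Keeping \<open>f\<close>
  abstract shows that the constants defined below depend on the parameters only and not on the
  solution.\<close>

locale blow_up =
  fixes \<alpha> \<gamma> \<kappa> \<eta> :: real and p :: "real \<Rightarrow> real \<Rightarrow> real" and f :: "real \<Rightarrow> real \<Rightarrow> ennreal"
  assumes index_gt: "1 < \<alpha>" and exponent_pos: "0 < \<gamma>"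
    and \<kappa>: "0 < \<kappa>" and \<eta>: "0 < \<eta>" "\<eta> \<le> 1"
    and kernel_lower: "\<And>t w. 0 < t \<Longrightarrow> \<bar>w\<bar> \<le> \<eta> * t powr (1 / \<alpha>) \<Longrightarrow> \<kappa> * t powr (- 1 / \<alpha>) \<le> p t w"
    and step: "\<And>t x r1 r2 z1 z2 q A. 0 < r1 \<Longrightarrow> r1 \<le> r2 \<Longrightarrow> r2 < t \<Longrightarrow> z1 \<le> z2 \<Longrightarrow> 0 \<le> q \<Longrightarrow> 0 < A \<Longrightarrow>
      (\<And>r z. r \<in> {r1..r2} \<Longrightarrow> z \<in> {z1..z2} \<Longrightarrow> q \<le> p (t - r) (x - z)) \<Longrightarrow>
      (\<And>r z. r \<in> {r1..r2} \<Longrightarrow> z \<in> {z1..z2} \<Longrightarrow> ennreal A \<le> f r z) \<Longrightarrow>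
      ennreal (q\<^sup>2 * (A / 2) powr (1 + \<gamma>) * (r2 - r1) * (z2 - z1)) \<le> 4 * f t x"
begin

section \<open>One-step propagation of lower bounds and of the value infinity\<close>

lemma infinite_step:
  assumes "0 < r1" "r1 < r2" "r2 < t" "z1 < z2" "0 < q"
    and q: "\<And>r z. r \<in> {r1..r2} \<Longrightarrow> z \<in> {z1..z2} \<Longrightarrow> q \<le> p (t - r) (x - z)"
    and inf: "\<And>r z. r \<in> {r1..r2} \<Longrightarrow> z \<in> {z1..z2} \<Longrightarrow> f r z = \<infinity>"
  shows "f t x = \<infinity>"
proof (rule ennreal_top_if_unbounded)
  fix v :: real assume v: "0 < v"
  define C where "C = q\<^sup>2 * (r2 - r1) * (z2 - z1)"
  have C: "0 < C" using assms by (simp add: C_def)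
  \<comment> \<open>The solution of \<open>C * (A / 2) powr (1 + \<gamma>) = v\<close>: on the box
    every \<open>A\<close> is an admissible lower bound.\<close>
  define A where "A = 2 * (v / C) powr (1 / (1 + \<gamma>))"
  have A: "0 < A" using v C by (simp add: A_def)
  have "ennreal (q\<^sup>2 * (A / 2) powr (1 + \<gamma>) * (r2 - r1) * (z2 - z1)) \<le> 4 * f t x"
    using assms A by (intro step) auto
  moreover have "(A / 2) powr (1 + \<gamma>) = v / C"
    using v C exponent_pos by (simp add: A_def powr_powr)
  then have "q\<^sup>2 * (A / 2) powr (1 + \<gamma>) * (r2 - r1) * (z2 - z1) = v"
    using C by (simp add: C_def field_simps)
  ultimately show "ennreal v \<le> 4 * f t x" by simp
qed

text \<open>Half the radius of the kernel bound at elapsed time \<open>\<delta> / 2\<close>, the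
  shortest one used in a step. Thus an interval of this length, placed at this distance from
  \<open>x\<close>, stays within the radius.\<close>

definition reach :: "real \<Rightarrow> real" where
  "reach \<delta> = \<eta> * (\<delta> / 2) powr (1 / \<alpha>) / 2"

text \<open>The linear lower bound gives away what \<alpha> > 1 offers; it is enough for the growth
  of finite values, while the transport of infinity uses the full size of
  \<open>reach\<close>.\<close>

lemma reach_bounds:
  assumes "0 < \<delta>" "\<delta> \<le> 1"
  shows "0 < reach \<delta>" "reach \<delta> \<le> 1 / 2" "\<eta> * \<delta> / 4 \<le> reach \<delta>"
proof -
  show "0 < reach \<delta>"
    using assms \<eta> by (simp add: reach_def)
  have "(\<delta> / 2) powr (1 / \<alpha>) \<le> 1"
    using assms index_gt by (intro powr_le1) auto
  then have "\<eta> * (\<delta> / 2) powr (1 / \<alpha>) \<le> 1 * 1"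
    using \<eta> by (intro mult_mono) auto
  then show "reach \<delta> \<le> 1 / 2"
    by (simp add: reach_def)
  have "(\<delta> / 2) powr 1 \<le> (\<delta> / 2) powr (1 / \<alpha>)"
    using assms index_gt by (intro powr_mono') auto
  then have "\<eta> * (\<delta> / 2) \<le> \<eta> * (\<delta> / 2) powr (1 / \<alpha>)"
    using assms \<eta> by (intro mult_left_mono) auto
  then show "\<eta> * \<delta> / 4 \<le> reach \<delta>"
    by (simp add: reach_def mult.commute)
qed

text \<open>The interval is moved from \<open>x\<close> towards the origin by
  \<open>reach \<delta>\<close>, which brings it back into the box even if \<open>x\<close> lies
  outside by that amount. It does not leave on the far side because
  \<open>reach \<delta> \<le> 1 / 2\<close> and \<open>1 \<le> R\<close>.\<close>

lemma reach_box:
  assumes R: "1 \<le> R" and \<delta>: "0 < \<delta>" "\<delta> \<le> 1" and x: "\<bar>x\<bar> \<le> R + reach \<delta>"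
  obtains z where "{z..z + reach \<delta>} \<subseteq> {-R..R}"
    "\<And>r y. r \<in> {t - \<delta>..t - \<delta> / 2} \<Longrightarrow> y \<in> {z..z + reach \<delta>} \<Longrightarrow> \<kappa> \<le> p (t - r) (x - y)"
proof -
  note b = reach_bounds[OF \<delta>]
  define z where "z = (if 0 \<le> x then x - 2 * reach \<delta> else x + reach \<delta>)"
  have sub: "{z..z + reach \<delta>} \<subseteq> {-R..R}"
    using b R x by (auto simp: z_def)
  have "\<kappa> \<le> p (t - r) (x - y)" if r: "r \<in> {t - \<delta>..t - \<delta> / 2}" and y: "y \<in> {z..z + reach \<delta>}" for r y
  proof -
    have tr: "\<delta> / 2 \<le> t - r" "t - r \<le> 1" "0 < t - r"
      using r \<delta> by auto
    have "\<bar>x - y\<bar> \<le> 2 * reach \<delta>"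
      using y b(1) by (auto simp: z_def split: if_splits)
    also have "\<dots> = \<eta> * (\<delta> / 2) powr (1 / \<alpha>)"
      by (simp add: reach_def)
    also have "\<dots> \<le> \<eta> * (t - r) powr (1 / \<alpha>)"
      using tr \<delta> \<eta> index_gt by (intro mult_left_mono powr_mono2) auto
    finally have "\<kappa> * (t - r) powr (- 1 / \<alpha>) \<le> p (t - r) (x - y)"
      using tr by (intro kernel_lower) auto
    \<comment> \<open>Elapsed times are at most 1, so the negative power only helps.\<close>
    moreover have "1 \<le> (t - r) powr (- 1 / \<alpha>)"
      using tr index_gt powr_mono'[of "- 1 / \<alpha>" 0 "t - r"] by simp
    then have "\<kappa> * 1 \<le> \<kappa> * (t - r) powr (- 1 / \<alpha>)"
      using \<kappa> by (intro mult_left_mono) auto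
    ultimately show ?thesis by simp
  qed
  with sub show thesis by (rule that)
qed

text \<open>The constant is the squared kernel bound \<kappa> times the duration
  \<open>\<delta> / 2\<close> times the lower bound \<open>\<eta> * \<delta> / 4\<close> for the
  length of the interval.\<close>

lemma finite_propagation:
  assumes R: "1 \<le> R" and \<delta>: "0 < \<delta>" "\<delta> \<le> 1" "\<delta> < t" and x: "\<bar>x\<bar> \<le> R + reach \<delta>" and A: "0 < A"
    and f: "\<And>r z. r \<in> {t - \<delta>..t - \<delta> / 2} \<Longrightarrow> \<bar>z\<bar> \<le> R \<Longrightarrow> ennreal A \<le> f r z"
  shows "ennreal (\<kappa>\<^sup>2 * \<eta> / 8 * \<delta>\<^sup>2 * (A / 2) powr (1 + \<gamma>)) \<le> 4 * f t x"
proof -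
  obtain z where z: "{z..z + reach \<delta>} \<subseteq> {-R..R}"
    "\<And>r y. r \<in> {t - \<delta>..t - \<delta> / 2} \<Longrightarrow> y \<in> {z..z + reach \<delta>} \<Longrightarrow> \<kappa> \<le> p (t - r) (x - y)"
    using reach_box[OF R \<delta>(1,2) x] by blast
  have "\<kappa>\<^sup>2 * \<eta> / 8 * \<delta>\<^sup>2 * (A / 2) powr (1 + \<gamma>) = \<kappa>\<^sup>2 * (A / 2) powr (1 + \<gamma>) * (\<delta> / 2) * (\<eta> * \<delta> / 4)"
    by (simp add: power2_eq_square)
  also have "\<dots> \<le> \<kappa>\<^sup>2 * (A / 2) powr (1 + \<gamma>) * (\<delta> / 2) * reach \<delta>"
    using \<delta> reach_bounds[OF \<delta>(1,2)] by (intro mult_left_mono) auto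
  also have "\<dots> = \<kappa>\<^sup>2 * (A / 2) powr (1 + \<gamma>) * (t - \<delta> / 2 - (t - \<delta>)) * (z + reach \<delta> - z)"
    by simp
  finally have "ennreal (\<kappa>\<^sup>2 * \<eta> / 8 * \<delta>\<^sup>2 * (A / 2) powr (1 + \<gamma>)) \<le> ennreal \<dots>"
    by (rule ennreal_leI)
  also have "\<dots> \<le> 4 * f t x"
    using \<delta> A \<kappa> reach_bounds[OF \<delta>(1,2)] z by (intro step f) (auto simp: subset_iff abs_le_iff)
  finally show ?thesis .
qed

text \<open>No constant is lost here, so the step can be repeated any number of times, each time
  widening the box by \<open>reach \<delta>\<close>.\<close>

lemma infinite_propagation:
  assumes R: "1 \<le> R" and \<delta>: "0 < \<delta>" "\<delta> \<le> 1" "\<delta> < t" and x: "\<bar>x\<bar> \<le> R + reach \<delta>"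
    and f: "\<And>r z. r \<in> {t - \<delta>..t - \<delta> / 2} \<Longrightarrow> \<bar>z\<bar> \<le> R \<Longrightarrow> f r z = \<infinity>"
  shows "f t x = \<infinity>"
proof -
  obtain z where z: "{z..z + reach \<delta>} \<subseteq> {-R..R}"
    "\<And>r y. r \<in> {t - \<delta>..t - \<delta> / 2} \<Longrightarrow> y \<in> {z..z + reach \<delta>} \<Longrightarrow> \<kappa> \<le> p (t - r) (x - y)"
    using reach_box[OF R \<delta>(1,2) x] by blast
  show ?thesis
    by (rule infinite_step[of "t - \<delta>" "t - \<delta> / 2" t z "z + reach \<delta>" \<kappa>])
       (use \<delta> \<kappa> reach_bounds[OF \<delta>(1,2)] z f in \<open>auto simp: subset_iff abs_le_iff\<close>)
qed

text \<open>
  \<open>growth\<close> solves \<open>growth powr \<gamma> = 4\<close>, which absorbs the factor \<open>\<delta>\<^sup>2 = 4\<^bsup>-(n+1)\<^esup>\<close> of the step, and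
  \<open>threshold\<close> turns \<open>growth_step\<close> into an equality.
\<close>

definition growth :: real where "growth = 4 powr (1 / \<gamma>)"
definition threshold :: real where
  "threshold = 2 * (256 * growth / (\<kappa>\<^sup>2 * \<eta>)) powr (1 / \<gamma>)"

lemma growth_gt_1: "1 < growth"
  unfolding growth_def using exponent_pos by (simp add: gr_one_powr)

lemma threshold_pos: "0 < threshold"
  unfolding threshold_def using growth_gt_1 \<kappa> \<eta> by simp

lemma growth_step:
  "4 * (threshold * growth ^ Suc n) \<le> \<kappa>\<^sup>2 * \<eta> / 8 * ((1 / 2) ^ Suc n)\<^sup>2 * (threshold * growth ^ n / 2) powr (1 + \<gamma>)"
proof -
  have g: "(growth ^ n) powr \<gamma> = 4 ^ n"
  proof -
    have "(growth ^ n) powr \<gamma> = (growth powr \<gamma>) powr real n"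
      using growth_gt_1 by (simp add: powr_realpow[symmetric] powr_powr mult.commute)
    then show ?thesis
      using exponent_pos by (simp add: growth_def powr_powr powr_realpow)
  qed
  have th: "(threshold / 2) powr \<gamma> = 256 * growth / (\<kappa>\<^sup>2 * \<eta>)"
    using exponent_pos growth_gt_1 \<kappa> \<eta> by (simp add: threshold_def powr_powr)
  have "(threshold * growth ^ n / 2) powr (1 + \<gamma>) =
    (threshold / 2 * growth ^ n) * (threshold / 2 * growth ^ n) powr \<gamma>"
    using threshold_pos growth_gt_1 by (simp add: powr_add)
  also have "\<dots> = (threshold / 2 * growth ^ n) * (256 * growth / (\<kappa>\<^sup>2 * \<eta>) * 4 ^ n)"
    using threshold_pos growth_gt_1 by (subst powr_mult) (simp_all add: g th)
  finally have eq: "(threshold * growth ^ n / 2) powr (1 + \<gamma>) =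
    (threshold / 2 * growth ^ n) * (256 * growth / (\<kappa>\<^sup>2 * \<eta>) * 4 ^ n)" .
  have h: "((1 / 2) ^ Suc n)\<^sup>2 * 4 ^ n = (1 / 4 :: real)"
    by (simp add: power_divide power2_eq_square power_mult_distrib[symmetric])
  have r: "a * h * (b * (c * q)) = a * (h * q) * (b * c)" for a h b c q :: real
    by (simp add: mult_ac)
  \<comment> \<open>Here 256 = 4 * 8 * 4 * 2: the 4 to be produced, and the denominators of
    \<open>\<eta> / 8\<close>, of \<open>h\<close> and of \<open>threshold / 2\<close>.\<close>
  have "\<kappa>\<^sup>2 * \<eta> / 8 * ((1 / 2) ^ Suc n)\<^sup>2 *
      ((threshold / 2 * growth ^ n) * (256 * growth / (\<kappa>\<^sup>2 * \<eta>) * 4 ^ n)) =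
    \<kappa>\<^sup>2 * \<eta> / 8 * (1 / 4) * ((threshold / 2 * growth ^ n) * (256 * growth / (\<kappa>\<^sup>2 * \<eta>)))"
    by (subst r) (simp only: h)
  also have "\<dots> = 4 * (threshold * growth ^ Suc n)"
    using \<kappa> \<eta> by (simp add: field_simps)
  finally show ?thesis
    unfolding eq by simp
qed

text \<open>Level \<open>n\<close> of the iteration is valid from time
  \<open>s + 1 - (1 / 2) ^ n\<close> on. The next level looks back by
  \<open>(1 / 2) ^ Suc n\<close>, exactly the distance between the two starting times. The delays
  sum to 1, so from \<open>s + 1\<close> on all levels hold at once.\<close>

lemma local_blow_up:
  assumes s: "0 < s" and f: "\<And>r z. r \<in> {s..s + 2} \<Longrightarrow> \<bar>z\<bar> \<le> 1 \<Longrightarrow> ennreal threshold \<le> f r z"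
    and r: "r \<in> {s + 1..s + 2}" and z: "\<bar>z\<bar> \<le> 1"
  shows "f r z = \<infinity>"
proof -
  have iter: "ennreal (threshold * growth ^ n) \<le> f r z"
    if "r \<in> {s + 1 - (1 / 2) ^ n..s + 2}" "\<bar>z\<bar> \<le> 1" for n r z
    using that
  proof (induction n arbitrary: r z)
    case 0
    then show ?case using f[of r z] by simp
  next
    case (Suc n)
    define \<delta> :: real where "\<delta> = (1 / 2) ^ Suc n"
    have \<delta>: "0 < \<delta>" "\<delta> \<le> 1" "(1 / 2) ^ n = 2 * \<delta>"
      using power_le_one[of "1 / 2 :: real" n] by (auto simp: \<delta>_def)
    have "\<delta> \<le> 1 / 2" by (simp add: \<delta>_def power_le_one)
    moreover have "s + 1 - \<delta> \<le> r" using Suc.prems(1) by (simp only: \<delta>_def atLeastAtMost_iff)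
    ultimately have "\<delta> < r" using s by linarith
    have "4 * ennreal (threshold * growth ^ Suc n) = ennreal (4 * (threshold * growth ^ Suc n))"
      using threshold_pos growth_gt_1 by (subst ennreal_mult'') auto
    also have "\<dots> \<le> ennreal (\<kappa>\<^sup>2 * \<eta> / 8 * \<delta>\<^sup>2 * (threshold * growth ^ n / 2) powr (1 + \<gamma>))"
      unfolding \<delta>_def by (intro ennreal_leI growth_step)
    also have "\<dots> \<le> 4 * f r z"
    proof (rule finite_propagation[where R = 1])
      show "0 < threshold * growth ^ n"
        using threshold_pos growth_gt_1 by simp
      show "\<bar>z\<bar> \<le> 1 + reach \<delta>"
        using Suc.prems reach_bounds[OF \<delta>(1,2)] by linarith
      fix r' z' assume "r' \<in> {r - \<delta>..r - \<delta> / 2}" "\<bar>z'\<bar> \<le> (1 :: real)"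
      then show "ennreal (threshold * growth ^ n) \<le> f r' z'"
        using Suc.prems \<delta> by (intro Suc.IH) (auto simp: \<delta>_def[symmetric])
    qed (use \<delta> \<open>\<delta> < r\<close> in auto)
    finally show ?case
      by (simp add: ennreal_mult_le_mult_iff)
  qed
  show ?thesis
  proof (rule ennreal_top_if_unbounded)
    fix v :: real assume "0 < v"
    obtain n where n: "v / threshold < growth ^ n"
      using real_arch_pow[OF growth_gt_1] by blast
    have "s + 1 - (1 / 2) ^ n \<le> r"
      using r zero_le_power[of "1 / 2 :: real" n] by (auto simp del: zero_le_power)
    have "v \<le> threshold * growth ^ n"
      using n threshold_pos by (simp add: field_simps)
    then have "ennreal v \<le> ennreal (threshold * growth ^ n)"
      by (rule ennreal_leI)
    also have "\<dots> \<le> f r z"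
      using \<open>s + 1 - (1 / 2) ^ n \<le> r\<close> r z by (intro iter) auto
    also have "\<dots> \<le> 4 * f r z"
      using mult_right_mono[of 1 "4 :: ennreal" "f r z"] by simp
    finally show "ennreal v \<le> 4 * f r z" .
  qed
qed

text \<open>The time at which the radius \<open>\<eta> * t powr (1 / \<alpha>)\<close> of the kernel
  bound equals 2, the diameter of the unit ball.\<close>

definition spread_time :: real where "spread_time = (2 / \<eta>) powr \<alpha>"

lemma spread_time_ge_1: "1 \<le> spread_time"
  unfolding spread_time_def using \<eta> index_gt by (intro ge_one_powr_ge_zero) auto

lemma reach_2_after_spread_time:
  assumes "spread_time \<le> t"
  shows "2 \<le> \<eta> * t powr (1 / \<alpha>)"
proof -
  have "2 = \<eta> * spread_time powr (1 / \<alpha>)"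
    using \<eta> index_gt by (simp add: spread_time_def powr_powr)
  also have "\<dots> \<le> \<eta> * t powr (1 / \<alpha>)"
    using assms spread_time_ge_1 \<eta> index_gt by (intro mult_left_mono powr_mono2) auto
  finally show "2 \<le> \<eta> * t powr (1 / \<alpha>)" .
qed

text \<open>The upper time \<open>T\<close> makes the bound uniform, since the factor
  \<open>t powr (- 1 / \<alpha>)\<close> decreases.\<close>

lemma kernel_unit_lower:
  assumes "spread_time \<le> t" "t \<le> T" "\<bar>w\<bar> \<le> 2"
  shows "\<kappa> * T powr (- 1 / \<alpha>) \<le> p t w"
proof -
  note b = spread_time_ge_1 reach_2_after_spread_time[OF assms(1)]
  have "T powr (- 1 / \<alpha>) \<le> t powr (- 1 / \<alpha>)"
    using assms b index_gt by (intro powr_mono2') auto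
  then have "\<kappa> * T powr (- 1 / \<alpha>) \<le> \<kappa> * t powr (- 1 / \<alpha>)"
    using \<kappa> by (intro mult_left_mono) auto
  also have "\<dots> \<le> p t w"
    using assms b by (intro kernel_lower) auto
  finally show ?thesis .
qed

text \<open>The time \<open>spread_time + 3\<close> is made up of 2 until the end of the window of
  local blow-up, \<open>spread_time\<close> until the kernel covers the unit ball, and 1 for the
  chain of steps that leads to \<open>x\<close>.\<close>

lemma global_blow_up:
  assumes s: "0 < s" and f: "\<And>r z. r \<in> {s..s + 2} \<Longrightarrow> \<bar>z\<bar> \<le> 1 \<Longrightarrow> ennreal threshold \<le> f r z"
    and t: "s + spread_time + 3 \<le> t"
  shows "f t x = \<infinity>"
proof -
  note st = spread_time_ge_1
  \<comment> \<open>The single window from \<open>s + 1\<close> to \<open>s + 2\<close> serves every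
    later time: the kernel bound decays in \<open>r\<close> but stays positive, and infinity absorbs
    it.\<close>
  have unit: "f r z = \<infinity>" if r: "s + spread_time + 2 \<le> r" and z: "\<bar>z\<bar> \<le> 1" for r z
  proof (rule infinite_step[of "s + 1" "s + 2" r "-1" 1 "\<kappa> * r powr (- 1 / \<alpha>)"])
    fix r' z' assume r': "r' \<in> {s + 1..s + 2}" and z': "z' \<in> {-1..1 :: real}"
    then show "f r' z' = \<infinity>"
      by (intro local_blow_up[OF s f]) auto
    show "\<kappa> * r powr (- 1 / \<alpha>) \<le> p (r - r') (z - z')"
      using r r' z z' s by (intro kernel_unit_lower) auto
  qed (use s r st \<kappa> in auto)
  have chain: "f r z = \<infinity>"
    if \<delta>: "0 < \<delta>" "\<delta> \<le> 1" and "s + spread_time + 2 + real m * \<delta> \<le> r" "\<bar>z\<bar> \<le> 1 + real m * reach \<delta>" for \<delta> m r z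
    using that(3,4)
  proof (induction m arbitrary: r z)
    case 0
    then show ?case using unit by simp
  next
    case (Suc m)
    show ?case
    proof (rule infinite_propagation[where R = "1 + real m * reach \<delta>" and \<delta> = \<delta>])
      show "1 \<le> 1 + real m * reach \<delta>"
        using reach_bounds[OF \<delta>] by simp
      show "\<delta> < r"
      proof -
        have "0 \<le> real m * \<delta>" using \<delta> by simp
        moreover have "real (Suc m) * \<delta> = real m * \<delta> + \<delta>" by (simp add: algebra_simps)
        ultimately show ?thesis using Suc.prems(1) s st by linarith
      qed
      show "\<bar>z\<bar> \<le> 1 + real m * reach \<delta> + reach \<delta>"
        using Suc.prems by (simp add: algebra_simps)
      fix r' z' assume "r' \<in> {r - \<delta>..r - \<delta> / 2}" "\<bar>z'\<bar> \<le> 1 + real m * reach \<delta>"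
      then show "f r' z' = \<infinity>"
        using Suc.prems by (intro Suc.IH) (auto simp: algebra_simps)
    qed (use \<delta> in auto)
  qed
  \<comment> \<open>The expression equals
    \<open>\<eta> / 4 * (2 * real n) powr (1 - 1 / \<alpha>)\<close>, with a positive
    exponent.\<close>
  have "filterlim (\<lambda>n. real n * (\<eta> * (1 / real n / 2) powr (1 / \<alpha>) / 2)) at_top sequentially"
  proof -
    have "1 - 1 / \<alpha> > 0" using index_gt by simp
    then have "filterlim (\<lambda>n. \<eta> / 4 * (2 * real n) powr (1 - 1 / \<alpha>)) at_top sequentially"
      using \<eta> by real_asymp
    moreover have "\<forall>\<^sub>F n in sequentially.
      \<eta> / 4 * (2 * real n) powr (1 - 1 / \<alpha>) = real n * (\<eta> * (1 / real n / 2) powr (1 / \<alpha>) / 2)"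
      using eventually_gt_at_top[of 0]
    proof eventually_elim
      case (elim n)
      have "(1 / real n / 2) powr (1 / \<alpha>) = 1 / (2 * real n) powr (1 / \<alpha>)"
        using elim by (simp add: powr_divide powr_mult mult.commute)
      then show ?case
        using elim by (simp add: powr_diff mult_ac)
    qed
    ultimately show ?thesis
      by (rule filterlim_cong[OF refl refl, THEN iffD1, rotated])
  qed
  then have "\<forall>\<^sub>F n in sequentially. \<bar>x\<bar> \<le> real n * reach (1 / real n)"
    unfolding filterlim_at_top reach_def by blast
  then have "\<forall>\<^sub>F n in sequentially. \<bar>x\<bar> \<le> real n * reach (1 / real n) \<and> 0 < n"
    using eventually_gt_at_top[of 0] by (rule eventually_conj)
  then obtain n where n: "\<bar>x\<bar> \<le> real n * reach (1 / real n)" "0 < n"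
    using eventually_happens'[OF sequentially_bot] by blast
  \<comment> \<open>The number \<open>n\<close> of steps depends on \<open>x\<close>, but their
    total duration \<open>n * (1 / n) = 1\<close> does not.\<close>
  show ?thesis
    by (rule chain[of "1 / real n" n]) (use n t in auto)
qed

end

section \<open>The stochastic heat equation\<close>

locale stochastic_heat = white_noise_space M W + stable_kernel \<alpha> p
  for M :: "'a measure" and W :: "(real \<times> real) set \<Rightarrow> 'a \<Rightarrow> real"
    and \<alpha> :: real and p :: "real \<Rightarrow> real \<Rightarrow> real" +
  fixes \<gamma> :: real and \<sigma> :: "real \<Rightarrow> real"
  assumes exponent_pos: "0 < \<gamma>" and superlinear: "\<And>x. \<bar>x\<bar> powr (1 + \<gamma>) \<le> \<sigma> x"
begin

lemma second_moment_lower_bound: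
  assumes u: "mild_solution M W p \<sigma> u0 u" and t: "0 < t"
  shows "ennreal ((heat_flow p u0 t x)\<^sup>2) +
      (\<integral>\<^sup>+ (\<omega>, s, y). ennreal ((mild_integrand p \<sigma> u t x \<omega> s y)\<^sup>2) \<partial>(M \<Otimes>\<^sub>M lborel))
    \<le> 4 * second_moment M u t x"
proof (cases "second_moment M u t x < \<infinity>")
  case False
  then show ?thesis
    by (simp add: not_less top_unique ennreal_mult_top)
next
  case True
  then obtain I where I: "has_walsh_integral M W (mild_integrand p \<sigma> u t x) I"
    and eq: "AE \<omega> in M. u t x \<omega> = heat_flow p u0 t x + I \<omega>"
    using u t unfolding mild_solution_def mild_equation_at_def by blast
  have "second_moment M u t x = (\<integral>\<^sup>+ \<omega>. ennreal ((heat_flow p u0 t x + I \<omega>)\<^sup>2) \<partial>M)"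
    unfolding second_moment_def by (intro nn_integral_cong_AE) (use eq in eventually_elim, simp)
  then show ?thesis
    using walsh_integral_lower_bound[OF I] by simp
qed

text \<open>\<open>stable_heat_kernel\<close> treats each time separately, so joint measurability is
  read off from the Walsh integral, which exists where the second moment is finite.\<close>

lemma mild_integrand_measurable:
  assumes u: "mild_solution M W p \<sigma> u0 u" and t: "0 < t" and "second_moment M u t x < \<infinity>"
  shows "(\<lambda>(\<omega>, s, y). mild_integrand p \<sigma> u t x \<omega> s y) \<in> borel_measurable (M \<Otimes>\<^sub>M lborel)"
  using assms unfolding mild_solution_def mild_equation_at_def has_walsh_integral_def by blast

text \<open>The integral of the squared integrand is restricted to the box and the expectation taken
  first, by Tonelli. On the box the kernel is at least \<open>q\<close>, and the moment inequality
  bounds the remaining expectation.\<close>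

lemma second_moment_step:
  assumes u: "mild_solution M W p \<sigma> u0 u"
    and r: "0 < r1" "r1 \<le> r2" "r2 < t" and z: "z1 \<le> z2" and q: "0 \<le> q" and A: "0 < A"
    and p: "\<And>r z. r \<in> {r1..r2} \<Longrightarrow> z \<in> {z1..z2} \<Longrightarrow> q \<le> p (t - r) (x - z)"
    and m: "\<And>r z. r \<in> {r1..r2} \<Longrightarrow> z \<in> {z1..z2} \<Longrightarrow> ennreal A \<le> second_moment M u r z"
  shows "ennreal (q\<^sup>2 * (A / 2) powr (1 + \<gamma>) * (r2 - r1) * (z2 - z1)) \<le> 4 * second_moment M u t x"
proof (cases "second_moment M u t x < \<infinity>")
  case False
  then show ?thesis
    by (simp add: not_less top_unique ennreal_mult_top)
next
  case True
  have t: "0 < t" using r by simp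
  let ?C = "q\<^sup>2 * (A / 2) powr (1 + \<gamma>)"
  let ?B = "{r1..r2} \<times> {z1..z2}"
  define F where "F = (\<lambda>(\<omega>, s, y). ennreal ((mild_integrand p \<sigma> u t x \<omega> s y)\<^sup>2))"
  have F: "F \<in> borel_measurable (M \<Otimes>\<^sub>M lborel)"
    using mild_integrand_measurable[OF u t True] unfolding F_def case_prod_beta by measurable
  have inner: "ennreal ?C \<le> (\<integral>\<^sup>+ \<omega>. F (\<omega>, s, y) \<partial>M)" if "(s, y) \<in> ?B" for s y
  proof -
    \<comment> \<open>The box lies strictly between the times 0 and \<open>t\<close>, so the cut-off
      in \<open>mild_integrand\<close> is not active.\<close>
    have s: "0 < s" "s < t" using that r by auto
    have um: "u s y \<in> borel_measurable M"
      using u s noise_filtration_measurable unfolding mild_solution_def adapted_field_def by blast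
    have "ennreal ((A / 2) powr (1 + \<gamma>)) \<le> (\<integral>\<^sup>+ \<omega>. ennreal ((\<bar>u s y \<omega>\<bar> powr (1 + \<gamma>))\<^sup>2) \<partial>M)"
      using um A m[of s y] that exponent_pos prob_space_axioms
      by (intro ennreal_power_mono_moment) (auto simp: second_moment_def)
    then have "ennreal ?C \<le> ennreal (q\<^sup>2) * (\<integral>\<^sup>+ \<omega>. ennreal ((\<bar>u s y \<omega>\<bar> powr (1 + \<gamma>))\<^sup>2) \<partial>M)"
      by (simp add: ennreal_mult' mult_left_mono)
    also have "\<dots> = (\<integral>\<^sup>+ \<omega>. ennreal (q\<^sup>2 * (\<bar>u s y \<omega>\<bar> powr (1 + \<gamma>))\<^sup>2) \<partial>M)"
      using um by (simp add: nn_integral_cmult ennreal_mult')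
    also have "\<dots> \<le> (\<integral>\<^sup>+ \<omega>. F (\<omega>, s, y) \<partial>M)"
    proof (intro nn_integral_mono)
      fix \<omega>
      have "q * \<bar>u s y \<omega>\<bar> powr (1 + \<gamma>) \<le> p (t - s) (x - y) * \<sigma> (u s y \<omega>)"
        using p[of s y] that q superlinear by (intro mult_mono) auto
      then have "(q * \<bar>u s y \<omega>\<bar> powr (1 + \<gamma>))\<^sup>2 \<le> (p (t - s) (x - y) * \<sigma> (u s y \<omega>))\<^sup>2"
        using q by (intro power_mono) auto
      then show "ennreal (q\<^sup>2 * (\<bar>u s y \<omega>\<bar> powr (1 + \<gamma>))\<^sup>2) \<le> F (\<omega>, s, y)"
        using s by (auto simp: F_def mild_integrand_def power_mult_distrib intro!: ennreal_leI)
    qed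
    finally show ?thesis .
  qed
  have B: "emeasure lborel ?B = ennreal ((r2 - r1) * (z2 - z1))"
  proof -
    have "emeasure (lborel \<Otimes>\<^sub>M lborel) ?B = emeasure lborel {r1..r2} * emeasure lborel {z1..z2}"
      by (intro lborel.emeasure_pair_measure_Times) auto
    then show ?thesis
      using r z by (simp add: lborel_prod ennreal_mult')
  qed
  have B_sets: "?B \<in> sets lborel"
  proof -
    have "?B \<in> sets (borel \<Otimes>\<^sub>M borel)" by simp
    then show ?thesis unfolding borel_prod by simp
  qed
  have "ennreal (q\<^sup>2 * (A / 2) powr (1 + \<gamma>) * (r2 - r1) * (z2 - z1)) = ennreal ?C * emeasure lborel ?B"
    using r z unfolding B by (simp add: ennreal_mult'[symmetric] mult.assoc)
  also have "\<dots> = (\<integral>\<^sup>+ p. ennreal ?C * indicator ?B p \<partial>lborel)"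
    using B_sets by (simp add: nn_integral_cmult_indicator)
  also have "\<dots> \<le> (\<integral>\<^sup>+ p. \<integral>\<^sup>+ \<omega>. F (\<omega>, p) \<partial>M \<partial>lborel)"
    using inner by (intro nn_integral_mono) (auto simp: indicator_def)
  also have "\<dots> = (\<integral>\<^sup>+ p. F p \<partial>(M \<Otimes>\<^sub>M lborel))"
    by (rule space_time.nn_integral_snd[OF F])
  also have "\<dots> \<le> 4 * second_moment M u t x"
    using second_moment_lower_bound[OF u t, of x] unfolding F_def
    by (rule order_trans[rotated]) simp
  finally show ?thesis .
qed

lemma heat_flow_lower_bound:
  assumes u0: "initial_condition u0" and t: "0 < t" and q: "0 \<le> q"
    and p: "\<And>z. \<bar>z\<bar> < 1 \<Longrightarrow> q \<le> p t (x - z)"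
  shows "q * initial_mass u0 \<le> heat_flow p u0 t x"
proof -
  have u0m [measurable]: "u0 \<in> borel_measurable borel" and nonneg: "0 \<le> u0 y" for y
    using u0 by (auto simp: initial_condition_def)
  obtain b where b: "\<bar>u0 y\<bar> \<le> b" for y
    using u0 unfolding initial_condition_def bounded_iff by (metis rangeI real_norm_def)
  have [measurable]: "p t \<in> borel_measurable borel" by (rule kernel_measurable[OF t])
  have "integrable lborel (\<lambda>y. p t (x + (-1) * y))"
    using lborel_integrable_real_affine[OF kernel_integral(1)[OF t], of "-1" x] by simp
  then have "integrable lborel (\<lambda>y. b * p t (x - y))" by simp
  \<comment> \<open>Boundedness of \<open>u0\<close> enters here. Integrability is essential for a
    lower bound, as the Bochner integral of a non-integrable function is 0 by default.\<close>
  then have int: "integrable lborel (\<lambda>y. p t (x - y) * u0 y)"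
  proof (rule Bochner_Integration.integrable_bound)
    show "AE y in lborel. norm (p t (x - y) * u0 y) \<le> norm (b * p t (x - y))"
    proof (rule AE_I2)
      fix y
      have "p t (x - y) * \<bar>u0 y\<bar> \<le> p t (x - y) * \<bar>b\<bar>"
        using b[of y] t by (intro mult_left_mono) auto
      then show "norm (p t (x - y) * u0 y) \<le> norm (b * p t (x - y))"
        using t by (simp add: abs_mult mult.commute)
    qed
  qed measurable
  have "integrable lborel (\<lambda>y::real. b * indicator (ball 0 1) y)"
    by (intro integrable_mult_right integrable_real_indicator) (use emeasure_bounded_finite[OF bounded_ball, of "0::real" 1] in auto)
  then have int0: "integrable lborel (\<lambda>y. indicator (ball 0 1) y * u0 y)"
  proof (rule Bochner_Integration.integrable_bound)
    show "AE y in lborel. norm (indicator (ball 0 1) y * u0 y) \<le> norm (b * indicator (ball 0 1) y)"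
      using b by (auto simp: indicator_def intro: order_trans[OF _ abs_ge_self])
    show "(\<lambda>y. indicator (ball 0 1) y * u0 y) \<in> borel_measurable lborel"
      using u0m by (intro borel_measurable_times borel_measurable_indicator) auto
  qed
  have "q * initial_mass u0 = (LINT y|lborel. q * (indicator (ball 0 1) y * u0 y))"
    by (simp add: initial_mass_def set_lebesgue_integral_def)
  also have "\<dots> \<le> (LINT y|lborel. p t (x - y) * u0 y)"
  proof (rule integral_mono)
    show "integrable lborel (\<lambda>y. q * (indicator (ball 0 1) y * u0 y))"
      using int0 by simp
    fix y
    show "q * (indicator (ball 0 1) y * u0 y) \<le> p t (x - y) * u0 y"
      using p[of y] nonneg[of y] t by (auto simp: indicator_def intro: mult_right_mono)
  qed (rule int)
  finally show ?thesis
    by (simp add: heat_flow_def)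
qed

lemma second_moment_blow_up:
  obtains t0 K where "0 \<le> t0" "0 < K"
    "\<And>u0 u t x. initial_condition u0 \<Longrightarrow> mild_solution M W p \<sigma> u0 u \<Longrightarrow> t0 \<le> t \<Longrightarrow>
      K \<le> initial_mass u0 \<Longrightarrow> second_moment M u t x = \<infinity>"
proof -
  obtain \<kappa> \<eta> where \<kappa>: "0 < \<kappa>" and \<eta>: "0 < \<eta>" "\<eta> \<le> 1"
    and lower: "\<And>t w. 0 < t \<Longrightarrow> \<bar>w\<bar> \<le> \<eta> * t powr (1 / \<alpha>) \<Longrightarrow> \<kappa> * t powr (- 1 / \<alpha>) \<le> p t w"
    using kernel_lower_bound by blast
  have blow_up: "blow_up \<alpha> \<gamma> \<kappa> \<eta> p (second_moment M u)" if "mild_solution M W p \<sigma> u0 u" for u0 u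
    by unfold_locales
      (use index_gt exponent_pos \<kappa> \<eta> lower second_moment_step[OF that] in auto)
  \<comment> \<open>From this time on the kernel bound covers the unit ball, so the mass of
    \<open>u0\<close> there is seen from each of its points.\<close>
  define s where "s = blow_up.spread_time \<alpha> \<eta>"
  define B where "B = blow_up.threshold \<gamma> \<kappa> \<eta>"
  \<comment> \<open>A lower bound for the kernel over the whole time window from \<open>s\<close> to
    \<open>s + 2\<close> and all distances up to 2.\<close>
  define q where "q = \<kappa> * (s + 2) powr (- 1 / \<alpha>)"
  \<comment> \<open>Solves \<open>(q * K)\<^sup>2 = 4 * B\<close>; the 4 cancels against the factor
    in \<open>second_moment_lower_bound\<close>.\<close>
  define K where "K = 2 * sqrt B / q"
  \<comment> \<open>The constants do not depend on \<open>f\<close>, and neither may the choice of \<open>K\<close>.\<close>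
  have "blow_up \<alpha> \<gamma> \<kappa> \<eta> p (\<lambda>_ _. \<infinity>)"
    by unfold_locales
      (use index_gt exponent_pos \<kappa> \<eta> lower in \<open>auto simp: ennreal_mult_top\<close>)
  then interpret bl: blow_up \<alpha> \<gamma> \<kappa> \<eta> p "\<lambda>_ _. \<infinity>" .
  have s: "1 \<le> s"
    unfolding s_def by (rule bl.spread_time_ge_1)
  have B: "0 < B"
    unfolding B_def by (rule bl.threshold_pos)
  have q: "0 < q"
    using \<kappa> s by (simp add: q_def)
  have K: "0 < K"
    using B q by (simp add: K_def)
  \<comment> \<open>The time \<open>2 * s + 3\<close> is the bound of \<open>global_blow_up\<close>
    at the starting time \<open>s\<close>, which is itself the spread time.\<close>
  have "second_moment M u t x = \<infinity>"
    if u0: "initial_condition u0" and u: "mild_solution M W p \<sigma> u0 u" and t: "2 * s + 3 \<le> t"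
      and mass: "K \<le> initial_mass u0" for u0 u t x
  proof (rule blow_up.global_blow_up[OF blow_up[OF u], of s])
    show "0 < s" "s + blow_up.spread_time \<alpha> \<eta> + 3 \<le> t"
      using s t by (auto simp: s_def)
    fix r z assume r: "r \<in> {s..s + 2}" and z: "\<bar>z\<bar> \<le> (1 :: real)"
    have "q * K \<le> q * initial_mass u0"
      using mass q by (intro mult_left_mono) auto
    also have "\<dots> \<le> heat_flow p u0 r z"
    proof (rule heat_flow_lower_bound[OF u0])
      fix y :: real assume "\<bar>y\<bar> < 1"
      then show "q \<le> p r (z - y)"
        unfolding q_def using r z by (intro bl.kernel_unit_lower) (auto simp: s_def)
    qed (use r s q in auto)
    finally have "2 * sqrt B \<le> heat_flow p u0 r z"
      using q by (simp add: K_def)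
    then have "(2 * sqrt B)\<^sup>2 \<le> (heat_flow p u0 r z)\<^sup>2"
      using B by (intro power_mono) auto
    then have "4 * B \<le> (heat_flow p u0 r z)\<^sup>2"
      using B by (simp add: power_mult_distrib)
    then have "4 * ennreal B \<le> ennreal ((heat_flow p u0 r z)\<^sup>2)"
      using B by (simp add: ennreal_mult''[symmetric] ennreal_leI flip: ennreal_numeral)
    also have "\<dots> \<le> 4 * second_moment M u r z"
      by (rule order_trans[OF _ second_moment_lower_bound[OF u, of r z]]) (use r s in auto)
    finally show "ennreal (blow_up.threshold \<gamma> \<kappa> \<eta>) \<le> second_moment M u r z"
      by (simp add: ennreal_mult_le_mult_iff B_def)
  qed
  with s K show thesis
    by (intro that[of "2 * s + 3" K]) auto
qed

end

theorem theorem1p8: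
  fixes \<alpha> \<gamma> :: real
    and \<sigma> :: "real \<Rightarrow> real"
    and p :: "real \<Rightarrow> real \<Rightarrow> real"
    and M :: "'a measure"
    and W :: "(real \<times> real) set \<Rightarrow> 'a \<Rightarrow> real"
  assumes "1 < \<alpha>" and "\<alpha> < 2"
    and "stable_heat_kernel \<alpha> p"
    and "locally_lipschitz \<sigma>"
    and "0 < \<gamma>" and "\<And>x. \<bar>x\<bar> powr (1 + \<gamma>) \<le> \<sigma> x"
    and "white_noise M W"
  shows "\<exists>t0\<ge>0. \<exists>K>0. \<forall>u0 u.
           initial_condition u0 \<and> 0 < initial_mass u0 \<and> mild_solution M W p \<sigma> u0 u \<longrightarrow>
           (\<forall>t\<ge>t0. \<forall>x. K \<le> initial_mass u0 \<longrightarrow> second_moment M u t x = \<infinity>)"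
proof -
  interpret stochastic_heat M W \<alpha> p \<gamma> \<sigma>
    using assms by unfold_locales auto
  obtain t0 K where "0 \<le> t0" "0 < K"
    "\<And>u0 u t x. initial_condition u0 \<Longrightarrow> mild_solution M W p \<sigma> u0 u \<Longrightarrow> t0 \<le> t \<Longrightarrow>
      K \<le> initial_mass u0 \<Longrightarrow> second_moment M u t x = \<infinity>"
    using second_moment_blow_up by blast
  then show ?thesis
    by (intro exI[of _ t0] exI[of _ K]) auto
qed

end
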